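(* Let $n\ge 1$ and $1<p<\infty$. There exists a weight $w$ on $\mathbb{R}^n$ that is doubling and satisfies the $C_p$ condition, but $w$ is not an $A_\infty$ weight.
   Context: A weight on $\mathbb{R}^n$ is a nonnegative locally integrable function $w$ that is not a.e. zero; it is identified with the measure $w(x)\,dx$, and $|E|_w=w(E)=\int_E w(x)\,dx$, while $|E|$ denotes Lebesgue measure. Cubes are cubes in $\mathbb{R}^n$, and $\lambda I$ denotes the cube with the same center as $I$ and $\lambda$ times its side length. Doubling: a nonzero measure $\omega$ is doubling if there is a constant $K>0$ such that $\omega(2I)\le K\,\omega(I)$ for all cubes $I\subset\mathbb{R}^n$; a weight $w$ is doubling if $w(x)\,dx$ is. $C_p$ condition ($1<p<\infty$): $w$ satisfies the $C_p$ condition if there exist $C,\epsilon>0$ such that for every cube $I$ one has $\int_{\mathbb{R}^n}(M\mathbf{1}_I(x))^p w(x)\,dx<\infty$ and $$\frac{|E|_w}{\int_{\mathbb{R}^n}|M\mathbf{1}_I(x)|^p w(x)\,dx}\le C\left(\frac{|E|}{|I|}\right)^{\epsilon}\quad\text{for every compact } E\subset I,$$ where $M$ is the classical Hardy–Littlewood maximal operator. $A_\infty$: $w\in A_\infty$ if there exist constants $C,\varepsilon>0$ such that $\frac{w(E)}{w(I)}\le C\left(\frac{|E|}{|I|}\right)^{\varepsilon}$ for all cubes $I\subset\mathbb{R}^n$ and all measurable $E\subset I$ (equivalently $w\in\bigcup_{q>1}A_q$, the union of the Muckenhoupt classes). *)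

theory Defs
  imports "HOL-Analysis.Analysis"
begin

(* Axis-parallel closed cube with centre c and side length l; a genuine cube when 0 < l.
   The dilate of cube c l by a factor a is cube c (a * l). *)
definition cube :: "real ^ 'n \<Rightarrow> real \<Rightarrow> (real ^ 'n) set" where
  "cube c l = cbox (\<chi> i. c $ i - l / 2) (\<chi> i. c $ i + l / 2)"

definition locally_integrable :: "(real ^ 'n \<Rightarrow> real) \<Rightarrow> bool" where
  "locally_integrable f \<longleftrightarrow>
     f \<in> borel_measurable lebesgue \<and> (\<forall>K. compact K \<longrightarrow> set_integrable lebesgue K f)"

definition weight :: "(real ^ 'n \<Rightarrow> real) \<Rightarrow> bool" where
  "weight w \<longleftrightarrow>
     (\<forall>x. 0 \<le> w x) \<and> locally_integrable w \<and> \<not> (AE x in lebesgue. w x = 0)"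

definition weight_measure :: "(real ^ 'n \<Rightarrow> real) \<Rightarrow> (real ^ 'n) measure" where
  "weight_measure w = density lebesgue (\<lambda>x. ennreal (w x))"

definition doubling_measure :: "(real ^ 'n) measure \<Rightarrow> bool" where
  "doubling_measure \<omega> \<longleftrightarrow>
     emeasure \<omega> (space \<omega>) \<noteq> 0 \<and>
     (\<exists>K::real. 0 < K \<and>
        (\<forall>c l. 0 < l \<longrightarrow> emeasure \<omega> (cube c (2 * l)) \<le> ennreal K * emeasure \<omega> (cube c l)))"

definition doubling :: "(real ^ 'n \<Rightarrow> real) \<Rightarrow> bool" where
  "doubling w \<longleftrightarrow> doubling_measure (weight_measure w)"

(* The uncentred Hardy-Littlewood maximal operator over cubes. *)
definition HL_maximal :: "(real ^ 'n \<Rightarrow> real) \<Rightarrow> real ^ 'n \<Rightarrow> ennreal" where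
  "HL_maximal f x =
     (SUP (c, l) \<in> {(c, l). 0 < l \<and> x \<in> cube c l}.
        (\<integral>\<^sup>+ y \<in> cube c l. ennreal \<bar>f y\<bar> \<partial>lebesgue) / emeasure lebesgue (cube c l))"

(* The library has no real powers on ennreal; for 0 < p this is the usual power. *)
definition ennreal_powr :: "ennreal \<Rightarrow> real \<Rightarrow> ennreal" where
  "ennreal_powr a p = (if a = top then top else ennreal (enn2real a powr p))"

definition maximal_mass :: "real \<Rightarrow> (real ^ 'n \<Rightarrow> real) \<Rightarrow> (real ^ 'n) set \<Rightarrow> ennreal" where
  "maximal_mass p w I =
     (\<integral>\<^sup>+ x. ennreal_powr (HL_maximal (indicator I) x) p * ennreal (w x) \<partial>lebesgue)"

(* In the next two definitions ratios of w-masses are formed in ennreal; a zero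
   denominator only ever occurs with a zero numerator, and 0 / 0 = 0. *)
definition C_p_condition :: "real \<Rightarrow> (real ^ 'n \<Rightarrow> real) \<Rightarrow> bool" where
  "C_p_condition p w \<longleftrightarrow>
     (\<exists>C \<epsilon>. 0 < C \<and> 0 < \<epsilon> \<and>
        (\<forall>c l. 0 < l \<longrightarrow>
           maximal_mass p w (cube c l) < \<infinity> \<and>
           (\<forall>E. compact E \<and> E \<subseteq> cube c l \<longrightarrow>
              emeasure (weight_measure w) E / maximal_mass p w (cube c l)
                \<le> ennreal (C * (measure lebesgue E / measure lebesgue (cube c l)) powr \<epsilon>))))"

definition A_infinity :: "(real ^ 'n \<Rightarrow> real) \<Rightarrow> bool" where
  "A_infinity w \<longleftrightarrow>
     (\<exists>C \<epsilon>. 0 < C \<and> 0 < \<epsilon> \<and>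
        (\<forall>c l E. 0 < l \<and> E \<in> sets lebesgue \<and> E \<subseteq> cube c l \<longrightarrow>
           emeasure (weight_measure w) E / emeasure (weight_measure w) (cube c l)
             \<le> ennreal (C * (measure lebesgue E / measure lebesgue (cube c l)) powr \<epsilon>)))"

end

theory Submission
  imports Defs
begin

text \<open>
  Write \<open>n\<close> for the dimension \<open>CARD('n)\<close>. The weight depends on one
  coordinate only, \<open>w x = v (x $ a)\<close> for a fixed coordinate \<open>a\<close>,
  where \<open>v = profile b\<close> is a bounded function on the line with countably many
  steps. It is equal to \<open>1\<close> far from the origin and is very small wherever it
  oscillates quickly.

  The condition \<open>C\<^sub>p\<close> is weaker than \<open>A\<^sub>\<infinity>\<close>
  because the maximal function of a cube \<open>I\<close> of side \<open>s \<le> 1\<close> is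
  still of size \<open>s ^ n\<close> at distance \<open>1\<close>. As \<open>w = 1\<close>
  far out, the mass \<open>\<integral> (M 1\<^sub>I) ^ p w\<close> is bounded below not
  only by \<open>w(I)\<close> but also by a multiple of \<open>s powr (n * p)\<close>. Hence
  a failure of regularity inside \<open>I\<close> does no harm when \<open>w\<close> is at most
  of size \<open>s powr (n * (p - 1))\<close> on \<open>I\<close>. This is made precise by
  the criterion \<open>C_p_condition_if_oscillation\<close>: it suffices that
  \<open>w x\<close> is bounded by a multiple of
  \<open>w y + s powr (n * (p - 1))\<close> for all points \<open>x\<close>,
  \<open>y\<close> of every cube of side \<open>s \<le> 1\<close>, and then the exponent
  \<open>\<epsilon> = 1\<close> works.

  The profile \<open>v\<close> is the density of a multiplicative cascade on the 4-adic
  intervals. The mass of an interval is distributed to its four quarters, and the mean density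
  of a quarter is that of the interval times a factor. The two cells at the origin have factors
  \<open>b\<close>, \<open>2 - b\<close>, \<open>1\<close>, \<open>1\<close>, counted from the
  origin, which makes \<open>v\<close> decay like a high power of the distance to
  \<open>0\<close>. All other cells have the factors \<open>1\<close>, \<open>1/25\<close>,
  \<open>49/25\<close>, \<open>1\<close> at first, and from some level on all factors are
  \<open>1\<close>. At distance about \<open>4 ^ - j\<close> from \<open>0\<close> the
  oscillating factors are used about \<open>j\<close> times, down to the scale
  \<open>4 ^ - (2 * j)\<close>.

  \<^item> Doubling: where a quarter touches a neighbour of its parent its factor is
    \<open>1\<close>, except at the origin, where both sides carry the same factor by symmetry.
    So neighbouring cells of the same level have densities that differ by at most one factor
    \<open>2 / b\<close> (\<open>cell_density_adjacent\<close>), uniformly over all levels.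
  \<^item> \<open>C\<^sub>p\<close>: the size of \<open>v\<close> at distance
    \<open>4 ^ - j\<close> is at most \<open>4 * 4 ^ j * b ^ j\<close>, which for
    small \<open>b\<close> is dominated by the power of the scale
    \<open>4 ^ - (2 * j)\<close> that the criterion allows
    (\<open>profile_oscillation\<close>).
  \<^item> Not \<open>A\<^sub>\<infinity>\<close>: the four factors have mean \<open>1\<close>,
    but their square roots have mean \<open>9/10\<close>. After \<open>j\<close> steps the mean
    of \<open>sqrt v\<close> has fallen by \<open>(9/10) ^ j\<close> relative to the square
    root of the mean of \<open>v\<close>, so nearly all the mass sits on a set of proportion at
    most \<open>(9/10) ^ j\<close> (\<open>peak_set_small\<close>,
    \<open>peak_set_heavy\<close>).
\<close>

section \<open>Cubes and the maximal function of a cube\<close>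

lemma mem_cube_coordinates: "x \<in> cube c l \<longleftrightarrow> (\<forall>i. c $ i - l / 2 \<le> x $ i \<and> x $ i \<le> c $ i + l / 2)"
  unfolding cube_def mem_box_cart by simp

lemma mem_cube_iff: "x \<in> cube c l \<longleftrightarrow> (\<forall>i. \<bar>x $ i - c $ i\<bar> \<le> l / 2)"
  unfolding mem_cube_coordinates by (intro arg_cong[of _ _ All] ext) linarith

lemma cube_measurable [measurable]: "cube c l \<in> sets borel"
  unfolding cube_def by simp

lemma cube_lebesgue [simp]: "cube c l \<in> sets lebesgue"
  by (simp add: cube_def)

text \<open>
  A product integral over the coordinates: each coordinate other than \<open>a\<close> contributes
  the factor \<open>l\<close>. It reduces every mass of the weight to a mass on the line.
\<close>
lemma nn_integral_cube_coordinate: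
  fixes c :: "real ^ 'n" and g :: "real \<Rightarrow> ennreal"
  assumes [measurable]: "g \<in> borel_measurable borel" and l: "0 < l"
  shows "(\<integral>\<^sup>+x\<in>cube c l. g (x $ a) \<partial>lborel)
       = ennreal (l ^ (CARD('n) - 1)) * (\<integral>\<^sup>+t\<in>{c $ a - l / 2 .. c $ a + l / 2}. g t \<partial>lborel)"
proof -
  let ?a = "axis a 1 :: real ^ 'n"
  let ?J = "\<lambda>b :: real ^ 'n. {c \<bullet> b - l / 2 .. c \<bullet> b + l / 2}"
  let ?f = "\<lambda>b t. indicator (?J b) t * (if b = ?a then g t else 1) :: ennreal"
  have a: "?a \<in> Basis" by (simp add: axis_in_Basis_iff)
  have ind: "(\<Prod>b\<in>Basis. indicator (?J b) (x \<bullet> b) :: ennreal) = indicator (cube c l) x" for x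
  proof (cases "x \<in> cube c l")
    case True
    then have "x \<bullet> b \<in> ?J b" if "b \<in> Basis" for b
      using that unfolding mem_cube_coordinates Basis_vec_def by (auto simp: inner_axis)
    then show ?thesis using True by simp
  next
    case False
    then obtain i where i: "\<not> (c $ i - l / 2 \<le> x $ i \<and> x $ i \<le> c $ i + l / 2)" unfolding mem_cube_coordinates by auto
    have "indicator (?J (axis i 1)) (x \<bullet> axis i 1) = (0 :: ennreal)"
      using i by (auto simp: inner_axis indicator_def)
    moreover have "axis i 1 \<in> (Basis :: (real ^ 'n) set)" by (simp add: axis_in_Basis_iff)
    ultimately have "(\<Prod>b\<in>Basis. indicator (?J b) (x \<bullet> b) :: ennreal) = 0"
      by (intro prod_zero[OF finite_Basis] bexI)
    then show ?thesis using False by simp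
  qed
  have prod_f: "(\<Prod>b\<in>Basis. ?f b (x \<bullet> b)) = g (x $ a) * indicator (cube c l) x" for x
  proof -
    have "(\<Prod>b\<in>Basis. if b = ?a then g (x \<bullet> b) else 1) = g (x \<bullet> ?a)"
      using a by (simp add: prod.delta)
    then show ?thesis unfolding prod.distrib ind by (simp add: inner_axis mult.commute)
  qed
  have "(\<integral>\<^sup>+x\<in>cube c l. g (x $ a) \<partial>lborel) = (\<integral>\<^sup>+x. (\<Prod>b\<in>Basis. ?f b (x \<bullet> b)) \<partial>lborel)"
    unfolding prod_f ..
  also have "\<dots> = (\<Prod>b\<in>Basis. \<integral>\<^sup>+t. ?f b t \<partial>lborel)"
    by (rule nn_integral_lborel_prod) auto
  also have "\<dots> = (\<integral>\<^sup>+t. ?f ?a t \<partial>lborel) * (\<Prod>b\<in>Basis - {?a}. \<integral>\<^sup>+t. ?f b t \<partial>lborel)"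
    using a by (intro prod.remove) auto
  also have "(\<Prod>b\<in>Basis - {?a}. \<integral>\<^sup>+t. ?f b t \<partial>lborel) = (\<Prod>b\<in>Basis - {?a}. ennreal l)"
    using l by (intro prod.cong) auto
  also have "\<dots> = ennreal (l ^ (CARD('n) - 1))"
    using a l by (simp add: card_Diff_singleton ennreal_power)
  also have "(\<integral>\<^sup>+t. ?f ?a t \<partial>lborel) = (\<integral>\<^sup>+t\<in>{c $ a - l / 2 .. c $ a + l / 2}. g t \<partial>lborel)"
    by (simp add: inner_axis mult.commute)
  finally show ?thesis by (simp add: mult.commute)
qed

lemma emeasure_cube:
  fixes c :: "real ^ 'n"
  assumes "0 < l"
  shows "emeasure lborel (cube c l) = ennreal (l ^ CARD('n))"
    and "emeasure lebesgue (cube c l) = ennreal (l ^ CARD('n))"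
proof -
  have "emeasure lborel (cube c l) = (\<integral>\<^sup>+x\<in>cube c l. 1 \<partial>lborel)" by simp
  also have "\<dots> = ennreal (l ^ (CARD('n) - 1)) * ennreal l"
    using nn_integral_cube_coordinate[where g = "\<lambda>_. 1" and l = l and c = c] assms by simp
  also have "\<dots> = ennreal (l ^ CARD('n))"
    using assms by (subst ennreal_mult'[symmetric]) (simp_all add: power_minus_mult[simplified])
  finally show *: "emeasure lborel (cube c l) = ennreal (l ^ CARD('n))" .
  then show "emeasure lebesgue (cube c l) = ennreal (l ^ CARD('n))" by simp
qed

lemma measure_cube: "0 < l \<Longrightarrow> measure lebesgue (cube c l) = l ^ CARD('n)" for c :: "real ^ 'n"
  unfolding measure_def by (subst emeasure_cube) auto

lemma emeasure_weight_measure: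
  assumes "w \<in> borel_measurable borel" "E \<in> sets lebesgue"
  shows "emeasure (weight_measure w) E = (\<integral>\<^sup>+x\<in>E. ennreal (w x) \<partial>lebesgue)"
  proof -
  have [measurable]: "w \<in> borel_measurable lebesgue"
    using assms(1) by (intro measurable_completion) simp
  show ?thesis unfolding weight_measure_def by (rule emeasure_density) (measurable, rule assms(2))
qed

lemma ennreal_powr_mono: "a \<le> b \<Longrightarrow> 0 \<le> p \<Longrightarrow> ennreal_powr a p \<le> ennreal_powr b p"
  unfolding ennreal_powr_def
  by (auto simp: top_unique less_top intro!: ennreal_leI powr_mono2 enn2real_mono)

lemma ennreal_powr_ennreal: "0 \<le> r \<Longrightarrow> ennreal_powr (ennreal r) p = ennreal (r powr p)"
  by (simp add: ennreal_powr_def)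

lemma HL_maximal_indicator_ge:
  fixes c c' :: "real ^ 'n"
  assumes s: "0 < s" and l: "0 < l" and sub: "cube c s \<subseteq> cube c' l" and x: "x \<in> cube c' l"
  shows "ennreal ((s / l) ^ CARD('n)) \<le> HL_maximal (indicator (cube c s)) x"
proof -
  have "(\<integral>\<^sup>+y\<in>cube c' l. ennreal \<bar>indicator (cube c s) y\<bar> \<partial>lebesgue) = (\<integral>\<^sup>+y. indicator (cube c s) y \<partial>lebesgue)"
    using sub by (intro nn_integral_cong) (auto simp: indicator_def)
  also have "\<dots> = ennreal (s ^ CARD('n))" using s by (simp add: emeasure_cube)
  finally have "ennreal ((s / l) ^ CARD('n))
      = (\<integral>\<^sup>+y\<in>cube c' l. ennreal \<bar>indicator (cube c s) y\<bar> \<partial>lebesgue) / emeasure lebesgue (cube c' l)"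
    using s l by (simp add: emeasure_cube divide_ennreal power_divide)
  then show ?thesis
    unfolding HL_maximal_def using l x by (intro SUP_upper2[of "(c', l)"]) auto
qed

lemma HL_maximal_indicator_le_1: "HL_maximal (indicator I) x \<le> 1" for x :: "real ^ 'n"
  unfolding HL_maximal_def
proof (rule SUP_least)
  fix z assume "z \<in> {(c, l). 0 < l \<and> x \<in> cube c l}"
  then obtain c l where z: "z = (c, l)" and l: "0 < l" by auto
  have "(\<integral>\<^sup>+y\<in>cube c l. ennreal \<bar>indicator I y\<bar> \<partial>lebesgue) \<le> (\<integral>\<^sup>+y. indicator (cube c l) y \<partial>lebesgue)"
    by (intro nn_integral_mono) (auto simp: indicator_def)
  also have "\<dots> = emeasure lebesgue (cube c l)" by simp
  finally have "(\<integral>\<^sup>+y\<in>cube c l. ennreal \<bar>indicator I y\<bar> \<partial>lebesgue) / emeasure lebesgue (cube c l)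
     \<le> emeasure lebesgue (cube c l) / emeasure lebesgue (cube c l)"
    by (rule divide_right_mono_ennreal)
  also have "\<dots> = 1" using l by (simp add: emeasure_cube divide_ennreal)
  finally show "(case z of (c, l) \<Rightarrow> (\<integral>\<^sup>+y\<in>cube c l. ennreal \<bar>indicator I y\<bar> \<partial>lebesgue)
      / emeasure lebesgue (cube c l)) \<le> 1" unfolding z prod.case .
qed

text \<open>
  A cube that meets \<open>cube c s\<close> and contains a point outside
  \<open>cube c (r * s)\<close> has side at least \<open>r * s / 4\<close>, so
  \<open>cube c s\<close> fills at most the fraction \<open>(4 / r) ^ n\<close> of it.
\<close>
lemma HL_maximal_indicator_far:
  fixes c x :: "real ^ 'n"
  assumes s: "0 < s" and r: "2 \<le> r" and x: "x \<notin> cube c (r * s)"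
  shows "HL_maximal (indicator (cube c s)) x \<le> ennreal ((4 / r) ^ CARD('n))"
  unfolding HL_maximal_def
proof (rule SUP_least)
  fix z assume "z \<in> {(c, l). 0 < l \<and> x \<in> cube c l}"
  then obtain c' l where z: "z = (c', l)" and l: "0 < l" and xl: "x \<in> cube c' l" by auto
  have "(\<integral>\<^sup>+y\<in>cube c' l. ennreal \<bar>indicator (cube c s) y\<bar> \<partial>lebesgue) / emeasure lebesgue (cube c' l)
     \<le> ennreal ((4 / r) ^ CARD('n))"
  proof (cases "cube c s \<inter> cube c' l = {}")
    case True
    then have "(\<integral>\<^sup>+y\<in>cube c' l. ennreal \<bar>indicator (cube c s) y\<bar> \<partial>lebesgue) = (\<integral>\<^sup>+y. 0 \<partial>(lebesgue :: (real ^ 'n) measure))"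
      by (intro nn_integral_cong) (auto simp: indicator_def)
    then show ?thesis by simp
  next
    case False
    then obtain y where y: "y \<in> cube c s" "y \<in> cube c' l" by auto
    obtain i where i: "r * s / 2 < \<bar>x $ i - c $ i\<bar>" using x unfolding mem_cube_iff by (auto simp: not_le)
    have "\<bar>x $ i - c' $ i\<bar> \<le> l / 2" "\<bar>y $ i - c' $ i\<bar> \<le> l / 2" "\<bar>y $ i - c $ i\<bar> \<le> s / 2"
      using xl y unfolding mem_cube_iff by auto
    then have "r * s / 2 < l + s / 2" using i by linarith
    moreover have "2 * s \<le> r * s" using r s by simp
    ultimately have "r * s / 4 \<le> l" by linarith
    then have "s / l \<le> 4 / r" using s r l by (simp add: field_simps)
    then have le: "(s / l) ^ CARD('n) \<le> (4 / r) ^ CARD('n)" using s l by (intro power_mono) auto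
    have "(\<integral>\<^sup>+y\<in>cube c' l. ennreal \<bar>indicator (cube c s) y\<bar> \<partial>lebesgue) \<le> (\<integral>\<^sup>+y. indicator (cube c s) y \<partial>lebesgue)"
      by (intro nn_integral_mono) (auto simp: indicator_def)
    also have "\<dots> = ennreal (s ^ CARD('n))" using s by (simp add: emeasure_cube)
    finally have "(\<integral>\<^sup>+y\<in>cube c' l. ennreal \<bar>indicator (cube c s) y\<bar> \<partial>lebesgue) / emeasure lebesgue (cube c' l)
      \<le> ennreal (s ^ CARD('n)) / emeasure lebesgue (cube c' l)"
      by (rule divide_right_mono_ennreal)
    also have "\<dots> = ennreal ((s / l) ^ CARD('n))"
      using s l by (simp add: emeasure_cube divide_ennreal power_divide)
    also have "\<dots> \<le> ennreal ((4 / r) ^ CARD('n))" using le by (rule ennreal_leI)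
    finally show ?thesis .
  qed
  then show "(case z of (c', l) \<Rightarrow> (\<integral>\<^sup>+y\<in>cube c' l. ennreal \<bar>indicator (cube c s) y\<bar> \<partial>lebesgue)
      / emeasure lebesgue (cube c' l)) \<le> ennreal ((4 / r) ^ CARD('n))" unfolding z prod.case .
qed

lemma ennreal_term_le_suminf: "f k \<le> suminf f" for f :: "nat \<Rightarrow> ennreal"
  using sum_le_suminf[OF summableI, of "{k}" f] by simp

text \<open>
  Splitting the space into dyadic shells around the cube turns the decay of the maximal function
  into a pointwise bound by a series of indicators, whose integrals are explicit.
\<close>
lemma HL_maximal_indicator_shells:
  fixes c x :: "real ^ 'n"
  assumes s: "0 < s" and p: "0 \<le> p"
  shows "ennreal_powr (HL_maximal (indicator (cube c s)) x) p
    \<le> (\<Sum>k. ennreal (((4 / 2 ^ k) ^ CARD('n)) powr p) * indicator (cube c (2 ^ Suc k * s)) x)"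
proof -
  have ex: "\<exists>k. x \<in> cube c (2 ^ Suc k * s)"
  proof -
    define R where "R = (\<Sum>i\<in>UNIV. \<bar>x $ i - c $ i\<bar>)"
    obtain k where "R / s < 2 ^ k" using real_arch_pow[of 2 "R / s"] by auto
    then have "R \<le> 2 ^ k * s" using s by (simp add: field_simps)
    moreover have "\<bar>x $ i - c $ i\<bar> \<le> R" for i
      unfolding R_def by (rule member_le_sum) auto
    ultimately have "x \<in> cube c (2 ^ Suc k * s)" unfolding mem_cube_iff by (auto intro: order_trans)
    then show ?thesis ..
  qed
  \<comment> \<open>The shell of the point; the first shell contains the cube itself, where only the trivial bound holds.\<close>
  define k where "k = (LEAST k. x \<in> cube c (2 ^ Suc k * s))"
  have k: "x \<in> cube c (2 ^ Suc k * s)" unfolding k_def using ex by (rule LeastI_ex)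
  have "HL_maximal (indicator (cube c s)) x \<le> ennreal ((4 / 2 ^ k) ^ CARD('n))"
  proof (cases k)
    case 0
    have "ennreal 1 \<le> ennreal (4 ^ CARD('n))" by (intro ennreal_leI one_le_power) simp
    then show ?thesis using HL_maximal_indicator_le_1[of "cube c s" x] 0 by (simp add: order_trans)
  next
    case (Suc j)
    then have "x \<notin> cube c (2 ^ k * s)" using not_less_Least[of j "\<lambda>k. x \<in> cube c (2 ^ Suc k * s)"] by (simp add: k_def)
    moreover have "(2::real) ^ 1 \<le> 2 ^ k" by (rule power_increasing) (use Suc in auto)
    ultimately show ?thesis using HL_maximal_indicator_far[OF s, of "2 ^ k" x c] by simp
  qed
  from ennreal_powr_mono[OF this p]
  have "ennreal_powr (HL_maximal (indicator (cube c s)) x) p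
     \<le> ennreal (((4 / 2 ^ k) ^ CARD('n)) powr p) * indicator (cube c (2 ^ Suc k * s)) x"
    using k by (simp add: ennreal_powr_ennreal)
  also have "\<dots> \<le> (\<Sum>k. ennreal (((4 / 2 ^ k) ^ CARD('n)) powr p) * indicator (cube c (2 ^ Suc k * s)) x)"
    by (rule ennreal_term_le_suminf)
  finally show ?thesis .
qed

text \<open>
  The shell series is geometric with ratio \<open>2 powr (n * (1 - p))\<close>, which is
  less than \<open>1\<close> because \<open>p > 1\<close>: the shells grow like
  \<open>2 ^ (k * n)\<close> and the maximal function to the power \<open>p\<close> decays
  like \<open>2 powr (- k * n * p)\<close>.
\<close>
lemma maximal_mass_finite:
  fixes c :: "real ^ 'n"
  assumes p: "1 < p" and s: "0 < s" and B: "\<And>x. w x \<le> B" "0 \<le> B"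
  shows "maximal_mass p w (cube c s) < \<infinity>"
proof -
  let ?n = "CARD('n)"
  define q where "q = (2::real) powr (real ?n * (1 - p))"
  have q: "0 \<le> q" "q < 1"
  proof -
    have "real ?n * (1 - p) < 0" using p by (intro mult_pos_neg) auto
    then show "q < 1" unfolding q_def using powr_less_mono[of _ 0 "2::real"] by simp
  qed (simp add: q_def)
  have eq: "((4 / 2 ^ k) ^ ?n) powr p * (2 ^ Suc k * s) ^ ?n = (4 ^ ?n) powr p * (2 * s) ^ ?n * q ^ k" for k
  proof -
    have 1: "((4 / 2 ^ k) ^ ?n) powr p = (4 ^ ?n) powr p / ((2 ^ k) ^ ?n) powr p"
      by (simp add: power_divide powr_divide)
    have 2: "((2 ^ k) ^ ?n) powr p = (2::real) powr (real k * real ?n * p)"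
      by (simp add: powr_powr[symmetric] powr_realpow power_mult[symmetric] flip: of_nat_mult)
    have 3: "q ^ k = 2 powr (real k * real ?n) / 2 powr (real k * real ?n * p)"
      unfolding q_def by (simp add: powr_realpow[symmetric] powr_powr powr_diff[symmetric] algebra_simps)
    have 4: "(2 ^ Suc k * s) ^ ?n = (2 * s) ^ ?n * 2 powr (real k * real ?n)"
      by (simp add: powr_realpow power_mult_distrib power_mult[symmetric] flip: of_nat_mult)
    show ?thesis unfolding 1 2 3 4 by (simp only: times_divide_eq_right times_divide_eq_left mult_ac)
  qed
  have "maximal_mass p w (cube c s)
     \<le> (\<integral>\<^sup>+x. (\<Sum>k. ennreal (((4 / 2 ^ k) ^ ?n) powr p) * indicator (cube c (2 ^ Suc k * s)) x) * ennreal B \<partial>lborel)"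
    unfolding maximal_mass_def nn_integral_completion
    by (intro nn_integral_mono mult_mono HL_maximal_indicator_shells ennreal_leI B) (use s p in auto)
  also have "\<dots> = (\<integral>\<^sup>+x. (\<Sum>k. ennreal (((4 / 2 ^ k) ^ ?n) powr p) * indicator (cube c (2 ^ Suc k * s)) x) \<partial>lborel) * ennreal B"
    by (rule nn_integral_multc) measurable
  also have "(\<integral>\<^sup>+x. (\<Sum>k. ennreal (((4 / 2 ^ k) ^ ?n) powr p) * indicator (cube c (2 ^ Suc k * s)) x) \<partial>lborel)
     = (\<Sum>k. \<integral>\<^sup>+x. ennreal (((4 / 2 ^ k) ^ ?n) powr p) * indicator (cube c (2 ^ Suc k * s)) x \<partial>lborel)"
    by (rule nn_integral_suminf) measurable
  also have "\<dots> = (\<Sum>k. ennreal ((4 ^ ?n) powr p * (2 * s) ^ ?n * q ^ k))"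
  proof (intro suminf_cong)
    fix k
    have "(\<integral>\<^sup>+x. ennreal (((4 / 2 ^ k) ^ ?n) powr p) * indicator (cube c (2 ^ Suc k * s)) x \<partial>lborel)
      = ennreal (((4 / 2 ^ k) ^ ?n) powr p) * ennreal ((2 ^ Suc k * s) ^ ?n)"
      using s by (subst nn_integral_cmult) (auto simp: emeasure_cube)
    also have "\<dots> = ennreal ((4 ^ ?n) powr p * (2 * s) ^ ?n * q ^ k)"
      using s unfolding eq[symmetric] by (subst ennreal_mult'[symmetric]) simp_all
    finally show "(\<integral>\<^sup>+x. ennreal (((4 / 2 ^ k) ^ ?n) powr p) * indicator (cube c (2 ^ Suc k * s)) x \<partial>lborel)
      = ennreal ((4 ^ ?n) powr p * (2 * s) ^ ?n * q ^ k)" .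
  qed
  also have "\<dots> = ennreal (\<Sum>k. (4 ^ ?n) powr p * (2 * s) ^ ?n * q ^ k)"
    by (rule suminf_ennreal2) (use s q in \<open>auto intro!: summable_mult summable_geometric\<close>)
  also have "\<dots> * ennreal B < \<infinity>" by (simp add: ennreal_mult_less_top)
  finally show ?thesis .
qed

lemma weight_measure_le_maximal_mass:
  fixes c :: "real ^ 'n"
  assumes [measurable]: "w \<in> borel_measurable borel" and s: "0 < s" and p: "0 \<le> p"
  shows "emeasure (weight_measure w) (cube c s) \<le> maximal_mass p w (cube c s)"
proof -
  have "1 \<le> ennreal_powr (HL_maximal (indicator (cube c s)) x) p" if "x \<in> cube c s" for x
    using ennreal_powr_mono[OF HL_maximal_indicator_ge[OF s s subset_refl that] p] s
    by (simp add: ennreal_powr_def)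
  then have le: "ennreal (w x) * indicator (cube c s) x
      \<le> ennreal_powr (HL_maximal (indicator (cube c s)) x) p * ennreal (w x)" for x
    using mult_right_mono[of 1 "ennreal_powr (HL_maximal (indicator (cube c s)) x) p" "ennreal (w x)"]
    by (cases "x \<in> cube c s") auto
  show ?thesis
    unfolding maximal_mass_def emeasure_weight_measure[OF assms(1) cube_lebesgue]
    by (rule nn_integral_mono[OF le])
qed

text \<open>
  The tail of the maximal function alone: the cube \<open>cube c (5 * t)\<close> is an
  admissible competitor for every point of \<open>cube c' t\<close>. For
  \<open>s \<le> t = 1\<close> this gives the lower bound by a multiple of
  \<open>s powr (n * p)\<close>.
\<close>
lemma maximal_mass_ge_far:
  fixes c c' :: "real ^ 'n"
  assumes [measurable]: "w \<in> borel_measurable borel" and p: "0 \<le> p" and s: "0 < s" and t: "s \<le> t"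
    and sub: "cube c' t \<subseteq> cube c (5 * t)" and one: "\<And>x. x \<in> cube c' t \<Longrightarrow> 1 \<le> w x"
  shows "ennreal (((s / (5 * t)) ^ CARD('n)) powr p * t ^ CARD('n)) \<le> maximal_mass p w (cube c s)"
proof -
  let ?h = "((s / (5 * t)) ^ CARD('n)) powr p"
  have t0: "0 < t" using s t by simp
  have "cube c s \<subseteq> cube c (5 * t)"
  proof
    fix x assume "x \<in> cube c s"
    moreover have "s / 2 \<le> 5 * t / 2" using s t by simp
    ultimately show "x \<in> cube c (5 * t)" unfolding mem_cube_iff by (blast intro: order_trans)
  qed
  then have "ennreal ?h \<le> ennreal_powr (HL_maximal (indicator (cube c s)) x) p" if "x \<in> cube c' t" for x
    using ennreal_powr_mono[OF HL_maximal_indicator_ge[of s "5 * t" c c x] p] that sub s t0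
    by (auto simp: ennreal_powr_ennreal)
  then have "(\<integral>\<^sup>+x. ennreal ?h * indicator (cube c' t) x \<partial>lborel) \<le> maximal_mass p w (cube c s)"
    unfolding maximal_mass_def nn_integral_completion
  proof (intro nn_integral_mono)
    fix x
    assume *: "\<And>x. x \<in> cube c' t \<Longrightarrow> ennreal ?h \<le> ennreal_powr (HL_maximal (indicator (cube c s)) x) p"
    show "ennreal ?h * indicator (cube c' t) x \<le> ennreal_powr (HL_maximal (indicator (cube c s)) x) p * ennreal (w x)"
    proof (cases "x \<in> cube c' t")
      case True
      have "ennreal ?h * 1 \<le> ennreal_powr (HL_maximal (indicator (cube c s)) x) p * ennreal (w x)"
        by (rule mult_mono[OF *[OF True]]) (use one[OF True] in auto)
      then show ?thesis using True by simp
    qed simp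
  qed
  also have "(\<integral>\<^sup>+x. ennreal ?h * indicator (cube c' t) x \<partial>lborel) = ennreal ?h * ennreal (t ^ CARD('n))"
    using t0 by (subst nn_integral_cmult) (auto simp: emeasure_cube)
  finally show ?thesis using t0 by (simp add: ennreal_mult)
qed

text \<open>
  Averaging the oscillation hypothesis over \<open>y\<close> in a cube of side
  \<open>s \<le> 1\<close> bounds \<open>w x * s ^ n\<close> by
  \<open>H * (w(I) + s powr (n * p))\<close>, and both terms are controlled by the
  maximal mass: the first one by the values of the maximal function on \<open>I\<close>, the
  second one by its tail. Cubes of side larger than \<open>1\<close> need only the boundedness
  of \<open>w\<close>. So \<open>w\<close> is at most a multiple of the maximal mass divided by
  \<open>s ^ n\<close> on \<open>I\<close>, and integrating this over \<open>E\<close> gives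
  the condition with exponent \<open>1\<close>.
\<close>
lemma C_p_condition_if_oscillation:
  fixes w :: "real ^ 'n \<Rightarrow> real"
  assumes p: "1 < p" and w [measurable]: "w \<in> borel_measurable borel"
    and bounds: "\<And>x. 0 \<le> w x" "\<And>x. w x \<le> B" and H: "0 \<le> H"
    and osc: "\<And>x y s. 0 < s \<Longrightarrow> s \<le> 1 \<Longrightarrow> (\<And>i. \<bar>x $ i - y $ i\<bar> \<le> s) \<Longrightarrow>
        w x \<le> H * (w y + s powr (real CARD('n) * (p - 1)))"
    and far: "\<And>c t. 1 \<le> t \<Longrightarrow> \<exists>c'. cube c' t \<subseteq> cube c (5 * t) \<and> (\<forall>x\<in>cube c' t. 1 \<le> w x)"
  shows "C_p_condition p w"
proof -
  let ?n = "CARD('n)"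
  let ?m = "real ?n * (p - 1)"
  define Q where "Q = (5 ^ ?n :: real) powr p"
  have Q: "0 < Q" by (simp add: Q_def)
  have B: "0 \<le> B" using bounds order_trans by blast
  define C where "C = H * (1 + Q) + B * Q + 1"
  have C: "H * (1 + Q) \<le> C" "B * Q \<le> C" "0 < C"
    using H Q B unfolding C_def by (auto intro!: add_nonneg_pos add_nonneg_nonneg)
  have scale: "((s / (5 * t)) ^ ?n) powr p = ((s / t) ^ ?n) powr p / Q" if "0 < s" "0 < t" for s t
  proof -
    have "(s / (5 * t)) ^ ?n = (s / t) ^ ?n / 5 ^ ?n" by (simp add: power_divide power_mult_distrib)
    then show ?thesis unfolding Q_def using that by (simp add: powr_divide)
  qed
  have main: "\<exists>\<mu>. maximal_mass p w (cube c s) = ennreal \<mu> \<and> 0 < \<mu> \<and> (\<forall>x\<in>cube c s. w x * s ^ ?n \<le> C * \<mu>)"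
    if s: "0 < s" for c :: "real ^ 'n" and s
  proof -
    obtain \<mu> where \<mu>: "maximal_mass p w (cube c s) = ennreal \<mu>" "0 \<le> \<mu>"
      using maximal_mass_finite[where w = w and c = c, OF p s bounds(2) B] by (cases "maximal_mass p w (cube c s)") auto
    \<comment> \<open>Far cubes are available only from side 1 on; larger cubes are compared with a cube of their own size.\<close>
    define t where "t = max 1 s"
    have t: "1 \<le> t" "s \<le> t" "0 < t" by (auto simp: t_def)
    obtain c' where c': "cube c' t \<subseteq> cube c (5 * t)" "\<And>x. x \<in> cube c' t \<Longrightarrow> 1 \<le> w x"
      using far[OF t(1), of c] by auto
    have "ennreal (((s / (5 * t)) ^ ?n) powr p * t ^ ?n) \<le> ennreal \<mu>"
      using maximal_mass_ge_far[OF w _ s t(2) c', of p] p unfolding \<mu> by simp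
    then have low: "((s / t) ^ ?n) powr p * t ^ ?n \<le> Q * \<mu>"
      using \<mu>(2) Q unfolding scale[OF s t(3)] by (simp add: field_simps)
    moreover have "0 < ((s / t) ^ ?n) powr p * t ^ ?n" using s t by simp
    ultimately have "0 < Q * \<mu>" by linarith
    then have pos: "0 < \<mu>" using Q by (simp add: zero_less_mult_iff)
    have "w x * s ^ ?n \<le> C * \<mu>" if x: "x \<in> cube c s" for x
    proof (cases "s \<le> 1")
      case True
      then have "t = 1" by (simp add: t_def)
      have "(s ^ ?n) powr p = s powr ?m * s ^ ?n"
        using s by (simp add: powr_realpow[symmetric] powr_powr powr_add[symmetric] algebra_simps)
      then have low': "s powr ?m * s ^ ?n \<le> Q * \<mu>" using low unfolding \<open>t = 1\<close> by simp
      have "ennreal (w x) * emeasure lebesgue (cube c s) = (\<integral>\<^sup>+y. ennreal (w x) * indicator (cube c s) y \<partial>lborel)"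
        by (subst nn_integral_cmult) auto
      also have "\<dots> \<le> (\<integral>\<^sup>+y. ennreal H * (ennreal (w y) * indicator (cube c s) y + ennreal (s powr ?m) * indicator (cube c s) y) \<partial>lborel)"
      proof (intro nn_integral_mono)
        fix y
        have "w x \<le> H * (w y + s powr ?m)" if "y \<in> cube c s"
        proof (rule osc[OF s True])
          fix i
          have "\<bar>x $ i - c $ i\<bar> \<le> s / 2" "\<bar>y $ i - c $ i\<bar> \<le> s / 2" using x that unfolding mem_cube_iff by auto
          then show "\<bar>x $ i - y $ i\<bar> \<le> s" by linarith
        qed
        then show "ennreal (w x) * indicator (cube c s) y \<le> ennreal H * (ennreal (w y) * indicator (cube c s) y + ennreal (s powr ?m) * indicator (cube c s) y)"
          using bounds H by (auto simp: indicator_def ennreal_plus[symmetric] ennreal_mult'[symmetric] simp del: ennreal_plus intro!: ennreal_leI)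
      qed
      also have "\<dots> = ennreal H * (emeasure (weight_measure w) (cube c s) + ennreal (s powr ?m) * emeasure lebesgue (cube c s))"
        by (simp add: nn_integral_cmult nn_integral_add emeasure_weight_measure[OF w cube_lebesgue] nn_integral_completion)
      also have "\<dots> \<le> ennreal H * (ennreal \<mu> + ennreal (Q * \<mu>))"
      proof (intro mult_left_mono add_mono)
        show "emeasure (weight_measure w) (cube c s) \<le> ennreal \<mu>"
          using weight_measure_le_maximal_mass[OF w s, where p = p and c = c] p unfolding \<mu> by simp
        show "ennreal (s powr ?m) * emeasure lebesgue (cube c s) \<le> ennreal (Q * \<mu>)"
          using low' s by (simp add: emeasure_cube ennreal_mult'[symmetric] ennreal_leI)
      qed simp
      also have "\<dots> = ennreal (H * (1 + Q) * \<mu>)"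
        using H Q pos by (simp add: ennreal_plus[symmetric] ennreal_mult'[symmetric] algebra_simps del: ennreal_plus)
      finally have "w x * s ^ ?n \<le> H * (1 + Q) * \<mu>"
        using s bounds H Q pos by (simp add: emeasure_cube ennreal_mult'[symmetric])
      also have "\<dots> \<le> C * \<mu>" using C(1) pos by (intro mult_right_mono) auto
      finally show ?thesis .
    next
      case False
      then have "t = s" by (simp add: t_def)
      have "w x * s ^ ?n \<le> B * s ^ ?n" using bounds(2)[of x] s by (intro mult_right_mono) auto
      also have "\<dots> \<le> B * (Q * \<mu>)" using low s B unfolding \<open>t = s\<close> by (intro mult_left_mono) auto
      also have "\<dots> \<le> C * \<mu>" using C(2) pos mult_right_mono[OF C(2), of \<mu>] by (simp add: mult.assoc)
      finally show ?thesis .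
    qed
    then show ?thesis using \<mu>(1) pos by blast
  qed
  show ?thesis
    unfolding C_p_condition_def
  proof (rule exI[of _ C], rule exI[of _ 1], intro conjI allI impI)
    fix c :: "real ^ 'n" and s :: real assume s: "0 < s"
    obtain \<mu> where \<mu>: "maximal_mass p w (cube c s) = ennreal \<mu>" "0 < \<mu>" "\<And>x. x \<in> cube c s \<Longrightarrow> w x * s ^ ?n \<le> C * \<mu>"
      using main[OF s, of c] by auto
    show "maximal_mass p w (cube c s) < \<infinity>" unfolding \<mu> by simp
    fix E assume "compact E \<and> E \<subseteq> cube c s"
    then have E: "compact E" "E \<subseteq> cube c s" by auto
    have El: "E \<in> lmeasurable" using E(1) by (rule lmeasurable_compact)
    then have Es: "E \<in> sets lebesgue" by (simp add: fmeasurableD)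
    define e where "e = measure lebesgue E"
    have e: "emeasure lebesgue E = ennreal e" "0 \<le> e" using El by (auto simp: e_def emeasure_eq_measure2 fmeasurableD2)
    have "emeasure (weight_measure w) E = (\<integral>\<^sup>+x\<in>E. ennreal (w x) \<partial>lebesgue)" by (rule emeasure_weight_measure[OF w Es])
    also have "\<dots> \<le> (\<integral>\<^sup>+x. ennreal (C * \<mu> / s ^ ?n) * indicator E x \<partial>lebesgue)"
      using \<mu>(3) E(2) s by (intro nn_integral_mono) (auto simp: indicator_def field_simps intro!: ennreal_leI)
    also have "\<dots> = ennreal (C * \<mu> / s ^ ?n) * ennreal e"
      using Es by (subst nn_integral_cmult_indicator) (auto simp: e)
    also have "\<dots> = ennreal \<mu> * ennreal (C * (e / s ^ ?n))"
      using \<mu>(2) C(3) s e by (simp add: ennreal_mult'[symmetric] mult_ac)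
    finally have "emeasure (weight_measure w) E \<le> ennreal \<mu> * ennreal (C * (e / s ^ ?n))" .
    then have "emeasure (weight_measure w) E / ennreal \<mu> \<le> ennreal (C * (e / s ^ ?n))"
      using \<mu>(2) by (intro divide_le_posI_ennreal) auto
    moreover have "0 \<le> e / s ^ ?n" using e s by simp
    ultimately show "emeasure (weight_measure w) E / maximal_mass p w (cube c s)
        \<le> ennreal (C * (measure lebesgue E / measure lebesgue (cube c s)) powr 1)"
      unfolding \<mu>(1) measure_cube[OF s] e_def[symmetric] powr_one[OF \<open>0 \<le> e / s ^ ?n\<close>] by simp
  qed (use C in auto)
qed

section \<open>The cascade and its limit density\<close>

text \<open>
  The factors of the four quarters are squares whose sum is \<open>4\<close>, while the sum of
  their square roots is \<open>18/5 < 4\<close>. The outer two are \<open>1\<close>, so that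
  the density does not change next to the end points of a cell.
\<close>
definition digit_factor :: "nat \<Rightarrow> real" where
  "digit_factor d = (if d = 1 then 1/25 else if d = 2 then 49/25 else 1)"

text \<open>
  The factor of the cell \<open>i\<close> of level \<open>Suc k\<close> relative to its parent
  \<open>i div 4\<close>, where cells are numbered by their distance to the origin. The parent
  \<open>0\<close> touches the origin and has its own four factors. The bound
  \<open>2 ^ k\<close> on the parent stops the oscillation: a cell at distance
  \<open>4 ^ - j\<close> has number about \<open>4 ^ (k - j)\<close> at level
  \<open>k\<close>, and this exceeds \<open>2 ^ k\<close> from about
  \<open>k = 2 * j\<close> on.
\<close>
definition cell_factor :: "real \<Rightarrow> nat \<Rightarrow> nat \<Rightarrow> real" where
  "cell_factor b k i =
     (if i = 0 then b else if i = 1 then 2 - b else if i < 4 then 1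
      else if i div 4 < 2 ^ k then digit_factor (i mod 4) else 1)"

fun cell_density :: "real \<Rightarrow> nat \<Rightarrow> nat \<Rightarrow> real" where
  "cell_density b 0 i = 1"
| "cell_density b (Suc k) i = cell_density b k (i div 4) * cell_factor b k i"

text \<open>
  The numbering of the cells extended evenly to the negative half-line: the cells \<open>i\<close>
  and \<open>- 1 - i\<close> are reflections of each other. With floors instead of absolute
  values, the 4-adic parent of a cell is \<open>i div 4\<close> on both sides of the origin.
\<close>
definition mirror :: "int \<Rightarrow> nat" where
  "mirror i = nat (if 0 \<le> i then i else - 1 - i)"

definition addr :: "nat \<Rightarrow> real \<Rightarrow> nat" where
  "addr k x = mirror \<lfloor>4 ^ k * x\<rfloor>"

definition approx :: "real \<Rightarrow> nat \<Rightarrow> real \<Rightarrow> real" where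
  "approx b k x = cell_density b k (addr k x)"

text \<open>
  Off the origin the sequence is eventually constant, and at the origin it is
  \<open>b ^ k\<close>, so for \<open>0 < b < 1\<close> the limit exists everywhere.
\<close>
definition profile :: "real \<Rightarrow> real \<Rightarrow> real" where
  "profile b x = lim (\<lambda>k. approx b k x)"

definition cell :: "nat \<Rightarrow> int \<Rightarrow> real set" where
  "cell k i = {of_int i / 4 ^ k ..< (of_int i + 1) / 4 ^ k}"

lemma cell_factor_pos: "0 < b \<Longrightarrow> b \<le> 1 \<Longrightarrow> 0 < cell_factor b k i"
  by (auto simp: cell_factor_def digit_factor_def)

lemma cell_factor_le_2: "0 < b \<Longrightarrow> b \<le> 1 \<Longrightarrow> cell_factor b k i \<le> 2"
  by (auto simp: cell_factor_def digit_factor_def)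

lemma cell_density_pos: "0 < b \<Longrightarrow> b \<le> 1 \<Longrightarrow> 0 < cell_density b k i"
  by (induction k arbitrary: i) (auto simp: cell_factor_pos)

lemma cell_density_0: "cell_density b k 0 = b ^ k"
  by (induction k) (auto simp: cell_factor_def)

lemma cell_factor_adjacent:
  assumes b: "0 < b" "b \<le> 1/25"
  shows "i mod 4 \<noteq> 3 \<Longrightarrow> cell_factor b k (Suc i) \<le> 2 / b * cell_factor b k i"
    and "i mod 4 \<noteq> 3 \<Longrightarrow> cell_factor b k i \<le> 2 / b * cell_factor b k (Suc i)"
    and "i mod 4 = 3 \<Longrightarrow> cell_factor b k i = 1"
    and "i mod 4 = 3 \<Longrightarrow> cell_factor b k (Suc i) = 1"
proof -
  have B: "50 \<le> 2 / b" using b by (simp add: field_simps)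
  have pos: "0 < cell_factor b k i" for i using b cell_factor_pos by auto
  have big: "x \<le> 2 / b * y" if "x \<le> 50 * y" "0 < y" for x y :: real
    using mult_right_mono[OF B, of y] that by linarith
  have bb: "b * b \<le> 1" using b mult_mono[of b 1 b 1] by auto
  {
    assume m: "i mod 4 \<noteq> 3"
    then have d: "Suc i div 4 = i div 4" by presburger
    consider "i = 0" | "i = 1" | "i = 2" | "4 \<le> i" using m by (cases "i = 3") force+
    then have "cell_factor b k (Suc i) \<le> 2 / b * cell_factor b k i \<and>
        cell_factor b k i \<le> 2 / b * cell_factor b k (Suc i)"
    proof cases
      case 1
      then show ?thesis using b bb by (simp add: cell_factor_def field_simps power2_eq_square)
    next
      case 2
      then have "cell_factor b k i = 2 - b" "cell_factor b k (Suc i) = 1"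
        by (auto simp: cell_factor_def)
      then show ?thesis using b B big[of 1 "2 - b"] by simp
    next
      case 3
      then have "cell_factor b k i = 1" "cell_factor b k (Suc i) = 1"
        by (auto simp: cell_factor_def)
      then show ?thesis using B by simp
    next
      case 4
      have "x = 1/25 \<or> x = 49/25 \<or> x = 1" if "x = digit_factor n" for x n
        using that by (auto simp: digit_factor_def split: if_splits)
      then have r: "digit_factor n \<le> 50 * digit_factor n'" for n n'
        by (auto simp: digit_factor_def)
      have "cell_factor b k (Suc i) \<le> 50 * cell_factor b k i"
        "cell_factor b k i \<le> 50 * cell_factor b k (Suc i)"
        using 4 r by (auto simp: cell_factor_def d)
      then show ?thesis using big pos by auto
    qed
  }
  then show "i mod 4 \<noteq> 3 \<Longrightarrow> cell_factor b k (Suc i) \<le> 2 / b * cell_factor b k i"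
    "i mod 4 \<noteq> 3 \<Longrightarrow> cell_factor b k i \<le> 2 / b * cell_factor b k (Suc i)" by auto
  assume m: "i mod 4 = 3"
  then have "Suc i mod 4 = 0" "i \<ge> 3" "i \<noteq> 0" "i \<noteq> 1" by presburger+
  then show "cell_factor b k i = 1" "cell_factor b k (Suc i) = 1"
    using m by (auto simp: cell_factor_def digit_factor_def)
qed

text \<open>
  Neighbours with the same parent differ by the ratio of two factors of one parent. Neighbours
  with different parents have their own factors equal to \<open>1\<close>, so their ratio is
  that of the parents, which are neighbours again. Hence only one ratio of factors survives in
  the induction over the levels.
\<close>
lemma cell_density_adjacent:
  assumes b: "0 < b" "b \<le> 1/25"
  shows "cell_density b k (Suc i) \<le> 2 / b * cell_density b k i \<and>
         cell_density b k i \<le> 2 / b * cell_density b k (Suc i)"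
proof (induction k arbitrary: i)
  case 0
  then show ?case using b by (simp add: field_simps)
next
  case (Suc k)
  show ?case
  proof (cases "i mod 4 = 3")
    case True
    then have "Suc i div 4 = Suc (i div 4)" by presburger
    then show ?thesis using cell_factor_adjacent(3,4)[OF b True] Suc[of "i div 4"] by simp
  next
    case False
    then have d: "Suc i div 4 = i div 4" by presburger
    have "0 \<le> cell_density b k (i div 4)" using cell_density_pos[of b] b by (simp add: less_imp_le)
    from mult_left_mono[OF cell_factor_adjacent(1)[OF b False] this]
      mult_left_mono[OF cell_factor_adjacent(2)[OF b False] this]
    show ?thesis by (simp add: d mult_ac)
  qed
qed

lemma cell_density_shift:
  assumes b: "0 < b" "b \<le> 1/25" and "i \<le> j + n" "j \<le> i + n"
  shows "cell_density b k i \<le> (2 / b) ^ n * cell_density b k j"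
  using assms(3,4)
proof (induction n arbitrary: i)
  case 0
  then show ?case by simp
next
  case (Suc n)
  have K: "1 \<le> 2 / b" using b by simp
  have p: "0 \<le> cell_density b k m" for m using cell_density_pos[of b] b by (simp add: less_imp_le)
  obtain i' where i': "i' \<le> j + n" "j \<le> i' + n" "i = i' \<or> i = Suc i' \<or> i' = Suc i"
  proof -
    consider "i \<le> j + n" "j \<le> i + n" | "i = Suc (j + n)" | "j = Suc (i + n)" using Suc.prems by linarith
    then show ?thesis
    proof cases
      case 1 then show ?thesis using that[of i] by auto
    next
      case 2 then show ?thesis using that[of "j + n"] by auto
    next
      case 3 then show ?thesis using that[of "Suc i"] by auto
    qed
  qed
  have "cell_density b k i \<le> 2 / b * cell_density b k i'"
    using i'(3) cell_density_adjacent[OF b, of k] mult_right_mono[OF K p[of i']] by auto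
  also have "\<dots> \<le> 2 / b * ((2 / b) ^ n * cell_density b k j)"
    by (rule mult_left_mono[OF Suc.IH[OF i'(1,2)]]) (use b in simp)
  finally show ?case by (simp add: mult_ac)
qed

lemma sum_children: "(\<Sum>d<4. f d) = f 0 + f 1 + f 2 + f (3::nat)" for f :: "nat \<Rightarrow> 'a::comm_monoid_add"
  by (simp add: eval_nat_numeral lessThan_Suc ac_simps)

lemma cell_factor_child:
  assumes "0 < i" "d < 4"
  shows "cell_factor b k (4 * i + d) = (if i < 2 ^ k then digit_factor d else 1)"
proof -
  have "(4 * i + d) div 4 = i" "(4 * i + d) mod 4 = d" using assms by presburger+
  then show ?thesis using assms by (auto simp: cell_factor_def)
qed

text \<open>
  Conservation of mass: the four factors of each parent have mean \<open>1\<close>.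
\<close>
lemma cell_density_mean: "(\<Sum>d<4. cell_density b (Suc k) (4 * i + d)) = 4 * cell_density b k i"
proof -
  have "(\<Sum>d<4. cell_factor b k (4 * i + d)) = 4"
  proof (cases "i = 0")
    case True
    then show ?thesis unfolding sum_children by (simp add: cell_factor_def)
  next
    case False
    then have "(\<Sum>d<4. cell_factor b k (4 * i + d)) = (\<Sum>d<4. if i < 2 ^ k then digit_factor d else 1)"
      by (intro sum.cong) (auto simp: cell_factor_child)
    then show ?thesis unfolding sum_children by (simp add: digit_factor_def)
  qed
  then show ?thesis
    by (simp add: sum_distrib_left[symmetric] del: sum.lessThan_Suc)
qed

text \<open>
  Where the cascade oscillates, the square root of the density loses the factor
  \<open>(1 + 1/5 + 7/5 + 1) / 4\<close> in the mean at each level.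
\<close>
lemma sqrt_cell_density_mean:
  assumes "0 < i" "i < 2 ^ k"
  shows "(\<Sum>d<4. sqrt (cell_density b (Suc k) (4 * i + d))) = 4 * (9/10) * sqrt (cell_density b k i)"
proof -
  have s: "sqrt (49/25) = 7/5" "sqrt (1/25) = 1/5"
    by (rule real_sqrt_unique; simp add: power2_eq_square)+
  have "(\<Sum>d<4. sqrt (cell_factor b k (4 * i + d))) = (\<Sum>d<4. sqrt (digit_factor d))"
    using assms by (intro sum.cong) (auto simp: cell_factor_child)
  also have "\<dots> = 4 * (9/10)"
    unfolding sum_children by (simp add: digit_factor_def s)
  finally show ?thesis
    by (simp add: real_sqrt_mult sum_distrib_left[symmetric] del: sum.lessThan_Suc)
qed

text \<open>
  A cell numbered below \<open>4 ^ (k - j)\<close> has descended from the origin cell for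
  \<open>j\<close> levels, each of which contributes a factor \<open>b\<close>; every remaining
  factor is at most \<open>2\<close>.
\<close>
lemma cell_density_le:
  assumes b: "0 < b" "b \<le> 1" and "j \<le> k" "i < 4 ^ (k - j)"
  shows "cell_density b k i \<le> 2 ^ k * b ^ j"
  using assms(3,4)
proof (induction k arbitrary: i)
  case 0
  then show ?case by simp
next
  case (Suc k)
  show ?case
  proof (cases "j = Suc k")
    case True
    then have "i = 0" using Suc.prems by simp
    have "1 * b ^ Suc k \<le> 2 ^ Suc k * b ^ Suc k"
      by (rule mult_right_mono[OF one_le_power]) (use b in auto)
    then show ?thesis using True cell_density_0[of b "Suc k"] unfolding \<open>i = 0\<close> by simp
  next
    case False
    then have "j \<le> k" "i div 4 < 4 ^ (k - j)"
      using Suc.prems by (auto simp: Suc_diff_le less_mult_imp_div_less mult.commute)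
    from mult_mono[OF Suc.IH[OF this] cell_factor_le_2[OF b, of k i]] b cell_factor_pos[OF b, of k i]
    show ?thesis by (simp add: mult_ac)
  qed
qed

text \<open>
  Passing to a child multiplies the number of a cell by at least \<open>4\<close> while the
  threshold only doubles, so a cell that has passed the threshold has only factors
  \<open>1\<close> below it.
\<close>
lemma cell_density_frozen:
  assumes "2 ^ k \<le> i div 4 ^ r"
  shows "cell_density b (k + r) i = cell_density b k (i div 4 ^ r)"
  using assms
proof (induction r arbitrary: i)
  case 0
  then show ?case by simp
next
  case (Suc r)
  have e: "i div 4 ^ Suc r = i div 4 div 4 ^ r" by (simp add: div_mult2_eq)
  have "2 ^ (k + r) \<le> (i div 4 div 4 ^ r) * 4 ^ r"
  proof -
    have "(2::nat) ^ r \<le> 4 ^ r" by (rule power_mono) auto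
    then show ?thesis using Suc.prems unfolding e power_add by (rule mult_le_mono[rotated])
  qed
  also have "\<dots> \<le> i div 4" by (simp add: div_times_less_eq_dividend)
  finally have "2 ^ (k + r) \<le> i div 4" .
  moreover then have "0 < i div 4" by (metis gr0I not_le zero_less_numeral zero_less_power)
  ultimately have "cell_factor b (k + r) i = 1"
    by (auto simp: cell_factor_def)
  then show ?case using Suc.IH[of "i div 4"] Suc.prems unfolding e by simp
qed

lemma mirror_div: "mirror i div 4 = mirror (i div 4)"
proof (cases "0 \<le> i")
  case True
  then show ?thesis by (auto simp: mirror_def nat_div_distrib pos_imp_zdiv_nonneg_iff)
next
  case False
  then have "i div 4 < 0" by simp
  moreover have "(- 1 - i) div 4 = - 1 - i div 4" by presburger
  ultimately show ?thesis using False
    by (simp add: mirror_def nat_div_distrib[symmetric])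
qed

lemma floor_div: "\<lfloor>4 ^ Suc k * x\<rfloor> div 4 = \<lfloor>4 ^ k * (x::real)\<rfloor>"
  using floor_divide_real_eq_div[of 4 "4 ^ Suc k * x"] by simp

lemma addr_Suc: "addr (Suc k) x div 4 = addr k x"
  unfolding addr_def mirror_div floor_div ..

lemma addr_add: "addr (k + r) x div 4 ^ r = addr k x"
proof (induction r)
  case (Suc r)
  have "addr (k + Suc r) x div 4 ^ Suc r = addr (Suc (k + r)) x div 4 div 4 ^ r"
    by (simp add: div_mult2_eq)
  then show ?case using Suc by (simp add: addr_Suc)
qed simp

lemma sum_mirror: "(\<Sum>d<4. f (mirror (4 * i + int d))) = (\<Sum>d<4. f (4 * mirror i + d))"
  for f :: "nat \<Rightarrow> 'a::comm_monoid_add"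
proof (cases "0 \<le> i")
  case True
  then have "mirror (4 * i + int d) = 4 * mirror i + d" for d
    by (simp add: mirror_def nat_add_distrib nat_mult_distrib)
  then show ?thesis by simp
next
  case False
  then have "mirror (4 * i) = 4 * mirror i + 3" "mirror (4 * i + 1) = 4 * mirror i + 2"
    "mirror (4 * i + 2) = 4 * mirror i + 1" "mirror (4 * i + 3) = 4 * mirror i"
    by (auto simp: mirror_def)
  then show ?thesis unfolding sum_children by (simp add: ac_simps)
qed

lemma mirror_close: "\<bar>i - j\<bar> \<le> 1 \<Longrightarrow> mirror i \<le> mirror j + 1"
  unfolding mirror_def by (cases "0 \<le> i"; cases "0 \<le> j"; simp; arith)

lemma mirror_eq_0_iff: "mirror i = 0 \<longleftrightarrow> i = 0 \<or> i = - 1"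
  unfolding mirror_def by (cases "0 \<le> i") auto

lemma addr_close:
  assumes "\<bar>x - y\<bar> < 1 / 4 ^ k"
  shows "addr k x \<le> addr k y + 1" "addr k y \<le> addr k x + 1"
proof -
  have "\<bar>4 ^ k * x - 4 ^ k * y\<bar> = 4 ^ k * \<bar>x - y\<bar>"
    by (simp add: right_diff_distrib[symmetric] abs_mult)
  also have "\<dots> < 1" using assms by (simp add: field_simps)
  finally have "\<bar>\<lfloor>4 ^ k * x\<rfloor> - \<lfloor>4 ^ k * y\<rfloor>\<bar> \<le> 1" by linarith
  then show "addr k x \<le> addr k y + 1" "addr k y \<le> addr k x + 1"
    unfolding addr_def using mirror_close [of "\<lfloor>4 ^ k * x\<rfloor>" "\<lfloor>4 ^ k * y\<rfloor>"]
      mirror_close[of "\<lfloor>4 ^ k * y\<rfloor>" "\<lfloor>4 ^ k * x\<rfloor>"] by (auto simp: abs_minus_commute)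
qed

lemma approx_frozen:
  assumes "2 ^ k \<le> addr k x" "k \<le> l"
  shows "approx b l x = approx b k x"
proof -
  obtain n where n: "l = k + n" using assms(2) by (auto simp: le_iff_add)
  show ?thesis
    using cell_density_frozen[of k "addr (k + n) x" n b] assms(1) unfolding addr_add n approx_def .
qed

lemma profile_frozen:
  assumes "2 ^ k \<le> addr k x"
  shows "profile b x = approx b k x"
proof -
  have "approx b (n + k) x = approx b k x" for n
    using approx_frozen[OF assms, of "n + k"] by simp
  then have "(\<lambda>n. approx b (n + k) x) \<longlonglongrightarrow> approx b k x" by simp
  then have "(\<lambda>n. approx b n x) \<longlonglongrightarrow> approx b k x" by (rule LIMSEQ_offset)
  then show ?thesis unfolding profile_def by (rule limI)
qed

lemma addr_eq_0_iff: "addr k x = 0 \<longleftrightarrow> - (1 / 4 ^ k) \<le> x \<and> x < 1 / 4 ^ k"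
proof -
  have "addr k x = 0 \<longleftrightarrow> \<lfloor>4 ^ k * x\<rfloor> = 0 \<or> \<lfloor>4 ^ k * x\<rfloor> = - 1"
    unfolding addr_def mirror_eq_0_iff ..
  also have "\<dots> \<longleftrightarrow> - 1 \<le> 4 ^ k * x \<and> 4 ^ k * x < 1" by linarith
  finally show ?thesis by (simp add: field_simps)
qed

text \<open>
  In the case \<open>shell\<close> the point lies at distance between
  \<open>4 ^ - Suc j\<close> and \<open>4 ^ - j\<close> from the origin, up to end
  points.
\<close>
lemma addr_zero_cases:
  obtains (zero) "x = 0" | (outside) "1 \<le> addr 0 x"
    | (shell) j where "addr j x = 0" "addr (Suc j) x \<noteq> 0"
proof (cases "x = 0 \<or> 1 \<le> addr 0 x")
  case True
  then show ?thesis using that by auto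
next
  case False
  have "\<exists>k. addr k x \<noteq> 0"
  proof -
    obtain k where "(1/4) ^ k < \<bar>x\<bar>" using real_arch_pow_inv[of "\<bar>x\<bar>" "1/4"] False by auto
    then show ?thesis by (intro exI[of _ k]) (auto simp: addr_eq_0_iff power_one_over)
  qed
  then obtain k where k: "addr k x \<noteq> 0" "\<And>l. l < k \<Longrightarrow> addr l x = 0"
    using exists_least_iff[of "\<lambda>k. addr k x \<noteq> 0"] by auto
  then obtain j where "k = Suc j" using False by (cases k) auto
  then show ?thesis using k that(3)[of j] by auto
qed

lemma addr_shell_ge:
  assumes "addr (Suc j) x \<noteq> 0"
  shows "4 ^ r \<le> addr (Suc j + r) x"
proof -
  have "1 \<le> addr (Suc j + r) x div 4 ^ r" using assms unfolding addr_add by simp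
  then have "1 * 4 ^ r \<le> addr (Suc j + r) x div 4 ^ r * 4 ^ r" by (rule mult_le_mono1)
  also have "\<dots> \<le> addr (Suc j + r) x" by simp
  finally show ?thesis by simp
qed

lemma approx_shell_le:
  assumes b: "0 < b" "b \<le> 1" and j: "addr j x = 0" "j \<le> k"
  shows "approx b k x \<le> 2 ^ k * b ^ j"
proof -
  have "addr k x div 4 ^ (k - j) = 0" using addr_add[of j "k - j" x] j by simp
  then have "addr k x < 4 ^ (k - j)" by (simp add: div_eq_0_iff)
  then show ?thesis unfolding approx_def using cell_density_le[OF b j(2)] by auto
qed

lemma four_power: "(4::'a::comm_semiring_1) ^ k = 2 ^ (k + k)"
  by (simp add: mult_2[symmetric] power_mult)

lemma approx_tendsto_profile:
  assumes b: "0 < b" "b < 1"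
  shows "(\<lambda>k. approx b k x) \<longlonglongrightarrow> profile b x"
proof -
  have fr: ?thesis if "2 ^ k \<le> addr k x" for k
  proof -
    have "approx b (n + k) x = profile b x" for n
      using approx_frozen[OF that, of "n + k" b] profile_frozen[OF that, of b] by simp
    then have "(\<lambda>n. approx b (n + k) x) \<longlonglongrightarrow> profile b x" by simp
    then show ?thesis by (rule LIMSEQ_offset)
  qed
  show ?thesis
  proof (cases rule: addr_zero_cases[of x])
    case zero
    then have "approx b k x = b ^ k" for k by (simp add: approx_def addr_def mirror_def cell_density_0)
    then have "(\<lambda>k. approx b k x) \<longlonglongrightarrow> 0" using b LIMSEQ_realpow_zero[of b] by simp
    then show ?thesis unfolding profile_def by (simp add: limI)
  next
    case outside
    then show ?thesis using fr[of 0] by simp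
  next
    case (shell j)
    \<comment> \<open>Oscillation in this shell has stopped at the level 2 * j + 2.\<close>
    have "(4::nat) ^ Suc j = 2 ^ (Suc j + Suc j)" by (rule four_power)
    then show ?thesis using fr[of "Suc j + Suc j"] addr_shell_ge[OF shell(2), of "Suc j"] by metis
  qed
qed

text \<open>
  By level \<open>2 * j + 2\<close> all oscillating factors of the shell have been used, and
  the bound \<open>2 ^ k * b ^ j\<close> at this level is
  \<open>4 * 4 ^ j * b ^ j\<close>. The second claim provides the domination for the
  passage to the limit under the integral.
\<close>
lemma profile_shell:
  assumes b: "0 < b" "b \<le> 1" and j: "addr j x = 0" "addr (Suc j) x \<noteq> 0"
  shows "profile b x \<le> 4 * 4 ^ j * b ^ j" and "\<And>k. approx b k x \<le> max 1 (4 * 4 ^ j * b ^ j)"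
proof -
  let ?N = "Suc j + Suc j"
  have e: "(4::nat) ^ Suc j = 2 ^ ?N" by (rule four_power)
  have e': "(4::real) ^ Suc j = 2 ^ ?N" by (rule four_power)
  have N: "approx b ?N x \<le> 4 * 4 ^ j * b ^ j" using approx_shell_le[OF b j(1), of ?N] e' by simp
  have ge: "2 ^ ?N \<le> addr ?N x" using addr_shell_ge[OF j(2), of "Suc j"] e by simp
  then show "profile b x \<le> 4 * 4 ^ j * b ^ j" using N profile_frozen[OF ge] by simp
  fix k
  consider "k < j" | "j \<le> k" "k \<le> ?N" | "?N \<le> k" by linarith
  then show "approx b k x \<le> max 1 (4 * 4 ^ j * b ^ j)"
  proof cases
    case 1
    have "addr k x = addr j x div 4 ^ (j - k)" using addr_add[of k "j - k" x] 1 by simp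
    then have "approx b k x = b ^ k" using j by (simp add: approx_def cell_density_0)
    then show ?thesis using b by (simp add: power_le_one max.coboundedI1)
  next
    case 2
    have "approx b k x \<le> 2 ^ k * b ^ j" by (rule approx_shell_le[OF b j(1) 2(1)])
    also have "\<dots> \<le> 2 ^ ?N * b ^ j" by (rule mult_right_mono[OF power_increasing[OF 2(2)]]) (use b in auto)
    also have "\<dots> = 4 * 4 ^ j * b ^ j" using e' by simp
    finally show ?thesis by simp
  next
    case 3
    then show ?thesis using N approx_frozen[OF ge 3, of b] by linarith
  qed
qed

lemma approx_bounds:
  assumes b: "0 < b" "b \<le> 1/4"
  shows "0 \<le> approx b k x" "approx b k x \<le> 4"
proof -
  show "0 \<le> approx b k x" using cell_density_pos[of b] b by (auto simp: approx_def less_imp_le)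
  show "approx b k x \<le> 4"
  proof (cases rule: addr_zero_cases[of x])
    case zero
    then have "approx b k x = b ^ k" by (simp add: approx_def addr_def mirror_def cell_density_0)
    then show ?thesis using b power_le_one[of b k] by simp
  next
    case outside
    have "approx b k x = 1" using approx_frozen[of 0 x k b] outside by (simp add: approx_def)
    then show ?thesis by simp
  next
    case (shell j)
    have "(4 * b) ^ j \<le> 1" by (rule power_le_one) (use b in auto)
    then show ?thesis using profile_shell(2)[OF _ _ shell, of b k] b
      by (simp add: power_mult_distrib mult.assoc)
  qed
qed

lemma profile_bounds:
  assumes b: "0 < b" "b \<le> 1/4"
  shows "0 \<le> profile b x" "profile b x \<le> 4"
  using LIMSEQ_le_const[OF approx_tendsto_profile[of b x], of 0]
    LIMSEQ_le_const2[OF approx_tendsto_profile[of b x], of 4] approx_bounds[OF b] b by auto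

lemma profile_outside: "x < - 1 \<or> 1 \<le> x \<Longrightarrow> profile b x = 1"
  using profile_frozen[of 0 x b] addr_eq_0_iff[of 0 x] by (auto simp: approx_def)

text \<open>
  Once the number of the cell of \<open>x\<close> strictly exceeds the threshold, the neighbouring
  cells have reached it too; so \<open>x\<close> and \<open>y\<close> see the final densities of
  two equal or neighbouring cells.
\<close>
lemma profile_local:
  assumes b: "0 < b" "b \<le> 1/25" and k: "2 ^ k < addr k x" and xy: "\<bar>x - y\<bar> < 1 / 4 ^ k"
  shows "profile b x \<le> 2 / b * profile b y"
proof -
  note c = addr_close[OF xy]
  then have "2 ^ k \<le> addr k y" using k by linarith
  then have "profile b y = cell_density b k (addr k y)" using profile_frozen by (simp add: approx_def)
  moreover have "profile b x = cell_density b k (addr k x)" using profile_frozen k by (simp add: approx_def)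
  ultimately show ?thesis using cell_density_shift[OF b, of "addr k x" "addr k y" 1 k] c by simp
qed

text \<open>
  Let \<open>x\<close> lie in the shell \<open>j\<close>. If \<open>y\<close> is closer than
  \<open>4 ^ - (2 * j + 4)\<close>, the two values are comparable by
  \<open>profile_local\<close>. Otherwise \<open>v x \<le> 4 * 4 ^ j * b ^ j\<close>
  is itself dominated by the power \<open>m\<close> of the distance; comparing the exponents of
  \<open>4\<close> leads to the condition \<open>1 + 2 * m \<le> M\<close>.
\<close>
lemma profile_oscillation:
  assumes M: "3 \<le> M" "1 + 2 * m \<le> real M" and m: "0 \<le> m" and b: "b = 1 / 4 ^ M"
  shows "profile b x \<le> (2 / b + 4 powr (1 + 4 * m)) * (profile b y + \<bar>x - y\<bar> powr m)"
proof -
  have "(4::real) ^ 3 \<le> 4 ^ M" by (rule power_increasing) (use M in auto)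
  then have b': "0 < b" "b \<le> 1/25" "b \<le> 1" "b \<le> 1/4" unfolding b by (auto simp: field_simps)
  let ?C = "4 powr (1 + 4 * m)"
  have nn: "0 \<le> profile b x" "0 \<le> profile b y" using profile_bounds b' by auto
  have key: "profile b x \<le> (2 / b + ?C) * (profile b y + \<bar>x - y\<bar> powr m)"
    if k: "2 ^ k < addr k x" and le: "profile b x \<le> ?C * (1 / 4 ^ k) powr m" for k
  proof (cases "\<bar>x - y\<bar> < 1 / 4 ^ k")
    case True
    have "profile b x \<le> 2 / b * profile b y" by (rule profile_local[OF b'(1,2) k True])
    also have "\<dots> \<le> (2 / b + ?C) * (profile b y + \<bar>x - y\<bar> powr m)"
      by (rule mult_mono) (use b' nn in auto)
    finally show ?thesis .
  next
    case False
    have "profile b x \<le> ?C * (1 / 4 ^ k) powr m" by (rule le)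
    also have "\<dots> \<le> ?C * \<bar>x - y\<bar> powr m"
      using False m by (intro mult_left_mono powr_mono2) auto
    also have "\<dots> \<le> (2 / b + ?C) * (profile b y + \<bar>x - y\<bar> powr m)"
      by (rule mult_mono) (use b' nn in auto)
    finally show ?thesis .
  qed
  have pw: "1 / 4 ^ k = 4 powr (- real k)" for k by (simp add: powr_minus powr_realpow divide_inverse)
  show ?thesis
  proof (cases rule: addr_zero_cases[of x])
    case zero
    have "profile b x = 0" using approx_tendsto_profile[of b x] LIMSEQ_realpow_zero[of b] b' zero
      by (auto simp: approx_def addr_def mirror_def cell_density_0 intro: LIMSEQ_unique)
    then show ?thesis using b' nn by simp
  next
    case outside
    have "4 \<le> addr 1 x" using addr_shell_ge[of 0 x 0] outside addr_add[of 0 1 x] by simp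
    moreover have "profile b x = 1" using profile_frozen[of 0 x b] outside by (simp add: approx_def)
    moreover have "1 \<le> ?C * (1 / 4 ^ 1) powr m" unfolding pw powr_powr powr_add[symmetric]
      by (rule ge_one_powr_ge_zero) (use m in auto)
    ultimately show ?thesis using key[of 1] by simp
  next
    case (shell j)
    have e: "(4::nat) ^ (j + 3) = 4 * 2 ^ (2 * j + 4)" by (simp add: power_add power_mult)
    have ge: "2 ^ (2 * j + 4) < addr (2 * j + 4) x"
    proof -
      have "Suc j + (j + 3) = 2 * j + 4" by simp
      then have "4 * 2 ^ (2 * j + 4) \<le> addr (2 * j + 4) x"
        using addr_shell_ge[OF shell(2), of "j + 3"] e by metis
      moreover have "(2::nat) ^ (2 * j + 4) > 0" by simp
      ultimately show ?thesis by linarith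
    qed
    have "profile b x \<le> 4 * 4 ^ j * b ^ j" by (rule profile_shell[OF b'(1,3) shell])
    also have "\<dots> = 4 powr (1 + real j - real M * real j)"
      unfolding b power_one_over power_mult[symmetric] 
      by (simp add: powr_diff powr_add powr_realpow[symmetric] power_mult[symmetric] field_simps)
    also have "\<dots> \<le> 4 powr (1 + 4 * m + (- real (2 * j + 4)) * m)"
    proof (rule powr_mono)
      have "real j * (1 + 2 * m) \<le> real j * real M" by (rule mult_left_mono[OF M(2)]) simp
      then show "1 + real j - real M * real j \<le> 1 + 4 * m + - real (2 * j + 4) * m"
        by (simp add: algebra_simps)
    qed simp
    also have "\<dots> = ?C * (1 / 4 ^ (2 * j + 4)) powr m"
      unfolding pw powr_powr powr_add[symmetric] ..
    finally show ?thesis using key[OF ge] by simp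
  qed
qed

section \<open>Masses of 4-adic intervals, doubling on the line and concentration\<close>

lemma mem_cell_iff: "x \<in> cell k i \<longleftrightarrow> \<lfloor>4 ^ k * x\<rfloor> = i"
  unfolding cell_def floor_eq_iff by (auto simp: field_simps)

lemma cell_measurable [measurable]: "cell k i \<in> sets borel"
  unfolding cell_def by simp

lemma emeasure_cell: "emeasure lborel (cell k i) = ennreal (1 / 4 ^ k)"
  unfolding cell_def by (subst emeasure_lborel_Ico) (auto simp: field_simps)

lemma approx_on_cell: "x \<in> cell k i \<Longrightarrow> approx b k x = cell_density b k (mirror i)"
  by (simp add: mem_cell_iff approx_def addr_def)

lemma approx_measurable [measurable]: "approx b k \<in> borel_measurable borel"
  unfolding approx_def addr_def by measurable

lemma profile_measurable [measurable]: "profile b \<in> borel_measurable borel"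
  unfolding profile_def by measurable

lemma nn_integral_cell_split:
  fixes g :: "real \<Rightarrow> ennreal"
  assumes [measurable]: "g \<in> borel_measurable borel"
  shows "(\<integral>\<^sup>+x\<in>cell k i. g x \<partial>lborel) = (\<Sum>d<4. \<integral>\<^sup>+x\<in>cell (Suc k) (4 * i + int d). g x \<partial>lborel)"
proof -
  have "indicator (cell k i) x = (\<Sum>d<4. indicator (cell (Suc k) (4 * i + int d)) x :: ennreal)" for x
  proof -
    have "n div 4 = i \<longleftrightarrow> n = 4 * i \<or> n = 4 * i + 1 \<or> n = 4 * i + 2 \<or> n = 4 * i + 3" for n
      by presburger
    from this[of "\<lfloor>4 ^ Suc k * x\<rfloor>"] show ?thesis
      unfolding sum_children floor_div indicator_def mem_cell_iff by auto
  qed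
  then have "(\<integral>\<^sup>+x\<in>cell k i. g x \<partial>lborel)
      = (\<integral>\<^sup>+x. (\<Sum>d<4. g x * indicator (cell (Suc k) (4 * i + int d)) x) \<partial>lborel)"
    by (simp add: sum_distrib_left)
  also have "\<dots> = (\<Sum>d<4. \<integral>\<^sup>+x\<in>cell (Suc k) (4 * i + int d). g x \<partial>lborel)"
    by (rule nn_integral_sum) measurable
  finally show ?thesis .
qed

text \<open>
  One induction for two cases: the identity with \<open>\<rho> = 1\<close> on all cells, and the
  square root with \<open>\<rho> = 9/10\<close> on the cells \<open>P\<close> where the
  cascade oscillates.
\<close>
lemma nn_integral_cell_approx:
  fixes \<phi> :: "real \<Rightarrow> real" and P :: "nat \<Rightarrow> nat \<Rightarrow> bool"
  assumes [measurable]: "\<phi> \<in> borel_measurable borel" and nonneg: "\<And>t. 0 \<le> t \<Longrightarrow> 0 \<le> \<phi> t"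
    and b: "0 < b" "b \<le> 1" and \<rho>: "0 \<le> \<rho>"
    and step: "\<And>l p d. P l p \<Longrightarrow> l < k + r \<Longrightarrow> d < 4 \<Longrightarrow> P (Suc l) (4 * p + d)"
    and mean: "\<And>l p. P l p \<Longrightarrow> l < k + r \<Longrightarrow>
        (\<Sum>d<4. \<phi> (cell_density b (Suc l) (4 * p + d))) = 4 * \<rho> * \<phi> (cell_density b l p)"
    and P: "P k (mirror i)"
  shows "(\<integral>\<^sup>+x\<in>cell k i. ennreal (\<phi> (approx b (k + r) x)) \<partial>lborel)
       = ennreal (\<rho> ^ r * \<phi> (cell_density b k (mirror i)) / 4 ^ k)"
  using step mean P
proof (induction r arbitrary: k i)
  case 0
  have "(\<integral>\<^sup>+x\<in>cell k i. ennreal (\<phi> (approx b (k + 0) x)) \<partial>lborel)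
      = (\<integral>\<^sup>+x\<in>cell k i. ennreal (\<phi> (cell_density b k (mirror i))) \<partial>lborel)"
    by (intro nn_integral_cong) (auto simp: indicator_def approx_on_cell)
  then show ?case
    using nonneg cell_density_pos[OF b, of k "mirror i"]
    by (simp add: nn_integral_cmult emeasure_cell less_imp_le del: ennreal_mult')
      (simp add: ennreal_mult'[symmetric] nonneg)
next
  case (Suc r)
  let ?A = "\<lambda>k i. \<phi> (cell_density b k i)"
  have nn: "0 \<le> ?A k i" for k i using nonneg cell_density_pos[OF b] by (simp add: less_imp_le)
  have IH: "(\<integral>\<^sup>+x\<in>cell (Suc k) j. ennreal (\<phi> (approx b (k + Suc r) x)) \<partial>lborel)
      = ennreal (\<rho> ^ r * ?A (Suc k) (mirror j) / 4 ^ Suc k)" if "P (Suc k) (mirror j)" for j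
    using Suc.IH[of "Suc k" j] Suc.prems that by simp
  have ch: "\<forall>d<4. P (Suc k) (mirror (4 * i + int d))"
  proof -
    have "mirror (4 * i + int d) = 4 * mirror i + mirror (4 * i + int d) mod 4" if "d < 4" for d
      using mirror_div[of "4 * i + int d"] that by (metis div_mult_self4 div_eq_0_iff add_0_right mult_div_mod_eq of_nat_less_iff of_nat_numeral of_nat_0_le_iff div_pos_pos_trivial zero_neq_numeral)
    then show ?thesis using Suc.prems(1)[OF Suc.prems(3)] by (metis less_add_same_cancel1 mod_less_divisor zero_less_Suc zero_less_numeral)
  qed
  have "(\<integral>\<^sup>+x\<in>cell k i. ennreal (\<phi> (approx b (k + Suc r) x)) \<partial>lborel)
      = (\<Sum>d<4. \<integral>\<^sup>+x\<in>cell (Suc k) (4 * i + int d). ennreal (\<phi> (approx b (k + Suc r) x)) \<partial>lborel)"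
    by (rule nn_integral_cell_split) measurable
  also have "\<dots> = (\<Sum>d<4. ennreal (\<rho> ^ r * ?A (Suc k) (mirror (4 * i + int d)) / 4 ^ Suc k))"
    using IH ch by (intro sum.cong) auto
  also have "\<dots> = (\<Sum>d<4. ennreal (\<rho> ^ r * ?A (Suc k) (4 * mirror i + d) / 4 ^ Suc k))"
    by (rule sum_mirror)
  also have "\<dots> = ennreal (\<Sum>d<4. \<rho> ^ r * ?A (Suc k) (4 * mirror i + d) / 4 ^ Suc k)"
    by (rule sum_ennreal) (intro divide_nonneg_nonneg mult_nonneg_nonneg zero_le_power \<rho> nn; simp)
  also have "(\<Sum>d<4. \<rho> ^ r * ?A (Suc k) (4 * mirror i + d) / 4 ^ Suc k)
      = \<rho> ^ r * (\<Sum>d<4. ?A (Suc k) (4 * mirror i + d)) / 4 ^ Suc k"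
    by (simp add: sum_distrib_left sum_divide_distrib)
  also have "(\<Sum>d<4. ?A (Suc k) (4 * mirror i + d)) = 4 * \<rho> * ?A k (mirror i)"
    using Suc.prems by auto
  finally show ?case by (simp add: field_simps)
qed

lemma nn_integral_cell_profile:
  assumes b: "0 < b" "b \<le> 1/4"
  shows "(\<integral>\<^sup>+x\<in>cell k i. ennreal (profile b x) \<partial>lborel) = ennreal (cell_density b k (mirror i) / 4 ^ k)"
proof -
  have eq: "(\<integral>\<^sup>+x\<in>cell k i. ennreal (approx b (k + r) x) \<partial>lborel) = ennreal (cell_density b k (mirror i) / 4 ^ k)" for r
    using nn_integral_cell_approx[of "\<lambda>t. t" b 1 "\<lambda>_ _. True" k r i] b cell_density_mean by simp
  have "(\<lambda>r. \<integral>\<^sup>+x\<in>cell k i. ennreal (approx b (k + r) x) \<partial>lborel)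
      \<longlonglongrightarrow> (\<integral>\<^sup>+x\<in>cell k i. ennreal (profile b x) \<partial>lborel)"
  proof (rule nn_integral_dominated_convergence[where w = "\<lambda>x. 4 * indicator (cell k i) x"])
    show "AE x in lborel. ennreal (approx b (k + j) x) * indicator (cell k i) x \<le> 4 * indicator (cell k i) x" for j
      using approx_bounds[OF b, of "k + j"] by (auto simp: indicator_def ennreal_numeral[symmetric] simp del: ennreal_numeral intro!: ennreal_leI)
    show "(\<integral>\<^sup>+x. 4 * indicator (cell k i) x \<partial>lborel) < \<infinity>"
      by (simp add: nn_integral_cmult emeasure_cell ennreal_mult_less_top)
    show "AE x in lborel. (\<lambda>j. ennreal (approx b (k + j) x) * indicator (cell k i) x)
        \<longlonglongrightarrow> ennreal (profile b x) * indicator (cell k i) x"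
    proof (rule AE_I2)
      fix x
      have "(\<lambda>j. approx b (k + j) x) \<longlonglongrightarrow> profile b x"
        using LIMSEQ_ignore_initial_segment[OF approx_tendsto_profile[of b x], of k] b by (simp add: add.commute)
      then show "(\<lambda>j. ennreal (approx b (k + j) x) * indicator (cell k i) x)
        \<longlonglongrightarrow> ennreal (profile b x) * indicator (cell k i) x"
        by (auto simp: indicator_def intro: tendsto_ennrealI)
    qed
  qed measurable
  then show ?thesis unfolding eq by (simp add: LIMSEQ_const_iff)
qed

text \<open>
  The cell \<open>2\<close> of level \<open>Suc j\<close> lies in the shell \<open>j\<close> and
  has density \<open>b ^ j\<close>. Its descendants \<open>p\<close> of level \<open>l\<close>
  satisfy \<open>2 * 4 ^ (l - Suc j) \<le> p < 3 * 4 ^ (l - Suc j)\<close>: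
  the upper bound keeps them below the threshold during exactly \<open>j\<close> levels, and the
  lower bound puts them beyond it right afterwards.
\<close>
lemma nn_integral_cell_sqrt_profile:
  assumes b: "0 < b" "b \<le> 1/4"
  shows "(\<integral>\<^sup>+x\<in>cell (Suc j) 2. ennreal (sqrt (profile b x)) \<partial>lborel)
       = ennreal ((9/10) ^ j * sqrt (b ^ j) / 4 ^ Suc j)"
proof -
  have d: "cell_density b (Suc j) (mirror 2) = b ^ j"
    by (simp add: mirror_def cell_density_0) (simp add: cell_factor_def)
  have "profile b x = approx b (Suc j + j) x" if "x \<in> cell (Suc j) 2" for x
  proof -
    have "addr (Suc j) x = 2" using that by (simp add: mem_cell_iff addr_def mirror_def)
    then have "addr (Suc j + j) x div 4 ^ j = 2" unfolding addr_add .
    then have "2 * 4 ^ j \<le> addr (Suc j + j) x"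
      by (metis div_times_less_eq_dividend)
    then have "2 ^ (Suc j + j) \<le> addr (Suc j + j) x" unfolding four_power by simp
    then show ?thesis by (rule profile_frozen)
  qed
  then have "(\<integral>\<^sup>+x\<in>cell (Suc j) 2. ennreal (sqrt (profile b x)) \<partial>lborel)
     = (\<integral>\<^sup>+x\<in>cell (Suc j) 2. ennreal (sqrt (approx b (Suc j + j) x)) \<partial>lborel)"
    by (intro nn_integral_cong) (auto simp: indicator_def)
  also have "\<dots> = ennreal ((9/10) ^ j * sqrt (cell_density b (Suc j) (mirror 2)) / 4 ^ Suc j)"
  proof (rule nn_integral_cell_approx[where P = "\<lambda>l p. Suc j \<le> l \<and> 0 < p \<and> p < 3 * 4 ^ (l - Suc j)"])
    fix l p d :: nat
    assume *: "Suc j \<le> l \<and> 0 < p \<and> p < 3 * 4 ^ (l - Suc j)" and l: "l < Suc j + j"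
    show "Suc j \<le> Suc l \<and> 0 < 4 * p + d \<and> 4 * p + d < 3 * 4 ^ (Suc l - Suc j)" if "d < 4"
    proof -
      have "4 ^ (Suc l - Suc j) = 4 * (4::nat) ^ (l - Suc j)" 
      proof -
        have "j < l" using * by simp
        then have "l - j = Suc (l - Suc j)" by simp
        then show ?thesis by simp
      qed
      then show ?thesis using * that by auto
    qed
    have "p < 4 * 4 ^ (l - Suc j)" using * by linarith
    also have "\<dots> = 4 ^ (l - j)"
    proof -
      have "j < l" using * by simp
      then have "l - j = Suc (l - Suc j)" by simp
      then show ?thesis by simp
    qed
    also have "\<dots> = 2 ^ (l - j + (l - j))" by (rule four_power)
    also have "\<dots> \<le> 2 ^ l" by (rule power_increasing) (use l in auto)
    finally show "(\<Sum>d<4. sqrt (cell_density b (Suc l) (4 * p + d))) = 4 * (9/10) * sqrt (cell_density b l p)"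
      using * by (intro sqrt_cell_density_mean) auto
  qed (use b in \<open>auto simp: mirror_def\<close>)
  finally show ?thesis unfolding d .
qed

text \<open>
  The part of the cell on which the profile exceeds its mean value \<open>b ^ j\<close> over the
  cell.
\<close>
definition peak_set :: "real \<Rightarrow> nat \<Rightarrow> real set" where
  "peak_set b j = {x \<in> cell (Suc j) 2. b ^ j < profile b x}"

lemma peak_set_measurable [measurable]: "peak_set b j \<in> sets borel"
  unfolding peak_set_def by measurable

text \<open>
  Markov's inequality for \<open>sqrt v\<close>.
\<close>
lemma peak_set_small:
  assumes b: "0 < b" "b \<le> 1/4"
  shows "emeasure lborel (peak_set b j) \<le> ennreal ((9/10) ^ j / 4 ^ Suc j)"
proof -
  have s: "0 < sqrt (b ^ j)" using b by simp
  have "ennreal (sqrt (b ^ j)) * emeasure lborel (peak_set b j)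
      = (\<integral>\<^sup>+x. ennreal (sqrt (b ^ j)) * indicator (peak_set b j) x \<partial>lborel)"
    by (simp add: nn_integral_cmult)
  also have "\<dots> \<le> (\<integral>\<^sup>+x\<in>cell (Suc j) 2. ennreal (sqrt (profile b x)) \<partial>lborel)"
    by (intro nn_integral_mono) (auto simp: indicator_def peak_set_def intro!: ennreal_leI)
  also have "\<dots> = ennreal (sqrt (b ^ j)) * ennreal ((9/10) ^ j / 4 ^ Suc j)"
    unfolding nn_integral_cell_sqrt_profile[OF b] using s by (subst ennreal_mult'[symmetric]) (auto simp: mult_ac)
  finally show ?thesis using s
    by (subst (asm) ennreal_mult_le_mult_iff) (auto simp: ennreal_eq_0_iff)
qed

text \<open>
  Off the peak set \<open>v \<le> sqrt (b ^ j) * sqrt v\<close>, so the mass there is at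
  most the proportion \<open>(9/10) ^ j\<close> of the mass of the cell.
\<close>
lemma peak_set_heavy:
  assumes b: "0 < b" "b \<le> 1/4"
  shows "ennreal (b ^ j * (1 - (9/10) ^ j) / 4 ^ Suc j)
      \<le> (\<integral>\<^sup>+x\<in>peak_set b j. ennreal (profile b x) \<partial>lborel)"
proof -
  have nn: "0 \<le> profile b x" for x by (rule profile_bounds[OF b])
  let ?c = "(9/10) ^ j * b ^ j / 4 ^ Suc j :: real"
  have "ennreal (b ^ j / 4 ^ Suc j) = (\<integral>\<^sup>+x\<in>cell (Suc j) 2. ennreal (profile b x) \<partial>lborel)"
    unfolding nn_integral_cell_profile[OF b] by (simp add: mirror_def cell_density_0) (simp add: cell_factor_def)
  also have "\<dots> = (\<integral>\<^sup>+x\<in>peak_set b j. ennreal (profile b x) \<partial>lborel)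
       + (\<integral>\<^sup>+x\<in>cell (Suc j) 2 - peak_set b j. ennreal (profile b x) \<partial>lborel)"
    by (subst nn_integral_add[symmetric]) (auto intro!: nn_integral_cong simp: indicator_def peak_set_def)
  also have "(\<integral>\<^sup>+x\<in>cell (Suc j) 2 - peak_set b j. ennreal (profile b x) \<partial>lborel)
     \<le> (\<integral>\<^sup>+x. ennreal (sqrt (b ^ j)) * (ennreal (sqrt (profile b x)) * indicator (cell (Suc j) 2) x) \<partial>lborel)"
  proof (intro nn_integral_mono)
    fix x
    have "profile b x \<le> sqrt (b ^ j) * sqrt (profile b x)" if "profile b x \<le> b ^ j"
      using mult_right_mono[OF real_sqrt_le_mono[OF that], of "sqrt (profile b x)"] nn[of x] by simp
    then show "ennreal (profile b x) * indicator (cell (Suc j) 2 - peak_set b j) x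
      \<le> ennreal (sqrt (b ^ j)) * (ennreal (sqrt (profile b x)) * indicator (cell (Suc j) 2) x)"
      using nn[of x] b by (auto simp: indicator_def peak_set_def ennreal_mult'[symmetric] intro!: ennreal_leI)
  qed
  also have "\<dots> = ennreal (sqrt (b ^ j)) * (\<integral>\<^sup>+x\<in>cell (Suc j) 2. ennreal (sqrt (profile b x)) \<partial>lborel)"
    by (rule nn_integral_cmult) measurable
  also have "\<dots> = ennreal ?c"
    unfolding nn_integral_cell_sqrt_profile[OF b] using b
    by (subst ennreal_mult'[symmetric]) auto
  finally have "ennreal (b ^ j / 4 ^ Suc j) - ennreal ?c
      \<le> (\<integral>\<^sup>+x\<in>peak_set b j. ennreal (profile b x) \<partial>lborel)"
    by (simp add: ennreal_minus_le_iff add.commute)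
  then show ?thesis using b
    by (subst (asm) ennreal_minus) (auto simp: field_simps)
qed

text \<open>
  Intervals of length below \<open>4\<close> are compared with 4-adic cells of a similar length:
  the interval contains the cell of its centre, and its double is covered by the
  \<open>33\<close> cells that are at most \<open>16\<close> steps away from that one. At least
  half of a longer interval lies where \<open>v = 1\<close>.
\<close>
lemma profile_doubling:
  assumes b: "0 < b" "b \<le> 1/25" and l: "0 < l"
  shows "(\<integral>\<^sup>+x\<in>{c - l .. c + l}. ennreal (profile b x) \<partial>lborel)
     \<le> ennreal (33 * (2 / b) ^ 16) * (\<integral>\<^sup>+x\<in>{c - l / 2 .. c + l / 2}. ennreal (profile b x) \<partial>lborel)"
    (is "?L \<le> ennreal ?K * ?R")
proof -
  have b4: "b \<le> 1/4" and B: "1 \<le> 2 / b" using b by (auto simp: field_simps)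
  have nn: "0 \<le> profile b x" "profile b x \<le> 4" for x using profile_bounds[OF b(1) b4] by auto
  have K: "33 \<le> ?K" using one_le_power[OF B, of 16] by simp
  show ?thesis
  proof (cases "4 \<le> l")
    case True
    have "?L \<le> (\<integral>\<^sup>+x. ennreal 4 * indicator {c - l .. c + l} x \<partial>lborel)"
      using nn by (intro nn_integral_mono) (auto simp: indicator_def simp del: ennreal_numeral intro!: ennreal_leI)
    also have "\<dots> = ennreal (8 * l)"
      using l by (simp add: nn_integral_cmult ennreal_mult'[symmetric] del: ennreal_numeral)
    finally have L: "?L \<le> ennreal (8 * l)" .
    have "ennreal (l - 2) \<le> emeasure lborel ({c - l / 2 .. c + l / 2} - {-1..1})"
    proof -
      have "emeasure lborel {c - l / 2 .. c + l / 2} \<le> emeasure lborel ({c - l / 2 .. c + l / 2} - {-1..1} \<union> {-1..1})"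
        by (rule emeasure_mono) auto
      also have "\<dots> \<le> emeasure lborel ({c - l / 2 .. c + l / 2} - {-1..1}) + emeasure lborel {-1..1::real}"
        by (rule emeasure_subadditive) auto
      finally have "ennreal l \<le> emeasure lborel ({c - l / 2 .. c + l / 2} - {-1..1}) + ennreal 2"
        using l by simp
      then have "ennreal l - ennreal 2 \<le> emeasure lborel ({c - l / 2 .. c + l / 2} - {-1..1})"
        by (simp add: ennreal_minus_le_iff add.commute)
      then show ?thesis by (subst (asm) ennreal_minus) auto
    qed
    also have "\<dots> = (\<integral>\<^sup>+x. indicator ({c - l / 2 .. c + l / 2} - {-1..1}) x \<partial>lborel)" by simp
    also have "\<dots> \<le> ?R"
      by (intro nn_integral_mono) (auto simp: indicator_def profile_outside not_le)
    finally have R: "ennreal (l - 2) \<le> ?R" .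
    have "33 * (l - 2) \<le> ?K * (l - 2)" by (rule mult_right_mono[OF K]) (use True in simp)
    moreover have "8 * l \<le> 33 * (l - 2)" using True by simp
    ultimately have "8 * l \<le> ?K * (l - 2)" by (rule order_trans[rotated])
    then have "ennreal (8 * l) \<le> ennreal ?K * ennreal (l - 2)"
      using True K by (subst ennreal_mult'[symmetric]) (auto intro!: ennreal_leI)
    with L have "?L \<le> ennreal ?K * ennreal (l - 2)" by (rule order_trans)
    also have "\<dots> \<le> ennreal ?K * ?R" using R by (rule mult_left_mono) simp
    finally show ?thesis .
  next
    case False
    \<comment> \<open>A cell that meets the centre and has at most half the length stays inside the interval.\<close>
    obtain k where k: "1 / 4 ^ k \<le> l / 2" "l / 2 < 4 / 4 ^ k"
    proof -
      define Q where "Q k \<longleftrightarrow> 1 / 4 ^ k \<le> l / 2" for k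
      obtain n where "(1/4) ^ n < l / 2" using real_arch_pow_inv[of "l / 2" "1/4"] l by auto
      then have "Q n" by (simp add: Q_def power_one_over)
      then have 1: "Q (LEAST k. Q k)" and 2: "\<And>k. k < (LEAST k. Q k) \<Longrightarrow> \<not> Q k"
        by (auto intro: LeastI dest: not_less_Least)
      show ?thesis
      proof (cases "LEAST k. Q k")
        case 0
        then show ?thesis using 1 False by (intro that[of 0]) (auto simp: Q_def)
      next
        case (Suc k)
        then show ?thesis using 1 2[of k] by (intro that[of "Suc k"]) (auto simp: Q_def)
      qed
    qed
    define i where "i = \<lfloor>4 ^ k * c\<rfloor>"
    have lk: "1 \<le> 4 ^ k * (l / 2)" "4 ^ k * (l / 2) < 4" using k by (auto simp: field_simps)
    have i: "of_int i \<le> 4 ^ k * c" "4 ^ k * c < of_int i + 1" unfolding i_def by linarith+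
    have small: "cell k i \<subseteq> {c - l / 2 .. c + l / 2}"
    proof
      fix x assume "x \<in> cell k i"
      then have "of_int i \<le> 4 ^ k * x" "4 ^ k * x < of_int i + 1" unfolding mem_cell_iff by linarith+
      then have "4 ^ k * (c - l / 2) \<le> 4 ^ k * x" "4 ^ k * x \<le> 4 ^ k * (c + l / 2)"
        using lk i unfolding right_diff_distrib distrib_left by linarith+
      then show "x \<in> {c - l / 2 .. c + l / 2}" by simp
    qed
    have large: "{c - l .. c + l} \<subseteq> (\<Union>j\<in>{i-16..i+16}. cell k j)"
    proof
      fix x assume "x \<in> {c - l .. c + l}"
      then have "4 ^ k * (c - l) \<le> 4 ^ k * x" "4 ^ k * x \<le> 4 ^ k * (c + l)" by auto
      then have "4 ^ k * x < of_int i + 9" "of_int i - 8 < 4 ^ k * x"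
        using lk i unfolding right_diff_distrib distrib_left by (auto simp: field_simps)
      then have "\<lfloor>4 ^ k * x\<rfloor> \<in> {i-16..i+16}" by auto linarith+
      then show "x \<in> (\<Union>j\<in>{i-16..i+16}. cell k j)" by (auto simp: mem_cell_iff)
    qed
    have "?L \<le> (\<integral>\<^sup>+x. (\<Sum>j\<in>{i-16..i+16}. ennreal (profile b x) * indicator (cell k j) x) \<partial>lborel)"
    proof (intro nn_integral_mono)
      fix x
      show "ennreal (profile b x) * indicator {c - l..c + l} x
          \<le> (\<Sum>j\<in>{i-16..i+16}. ennreal (profile b x) * indicator (cell k j) x)"
      proof (cases "x \<in> {c - l..c + l}")
        case True
        then obtain j where j: "j \<in> {i-16..i+16}" "x \<in> cell k j" using large by blast
        then have "ennreal (profile b x) * indicator {c - l..c + l} x \<le> ennreal (profile b x) * indicator (cell k j) x"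
          using True by simp
        also have "\<dots> \<le> (\<Sum>j\<in>{i-16..i+16}. ennreal (profile b x) * indicator (cell k j) x)"
          by (rule member_le_sum[OF j(1)]) auto
        finally show ?thesis .
      qed simp
    qed
    also have "\<dots> = (\<Sum>j\<in>{i-16..i+16}. \<integral>\<^sup>+x\<in>cell k j. ennreal (profile b x) \<partial>lborel)"
      by (rule nn_integral_sum) measurable
    also have "\<dots> \<le> (\<Sum>j\<in>{i-16..i+16}. ennreal ((2 / b) ^ 16) * (\<integral>\<^sup>+x\<in>cell k i. ennreal (profile b x) \<partial>lborel))"
    proof (rule sum_mono)
      fix j assume j: "j \<in> {i-16..i+16}"
      have "mirror j \<le> mirror i + 16" "mirror i \<le> mirror j + 16"
        using j unfolding mirror_def by (cases "0 \<le> i"; cases "0 \<le> j"; simp; arith)+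
      from cell_density_shift[OF b this, of k]
      have "cell_density b k (mirror j) / 4 ^ k \<le> (2 / b) ^ 16 * (cell_density b k (mirror i) / 4 ^ k)"
        by (simp add: field_simps)
      then show "(\<integral>\<^sup>+x\<in>cell k j. ennreal (profile b x) \<partial>lborel)
          \<le> ennreal ((2 / b) ^ 16) * (\<integral>\<^sup>+x\<in>cell k i. ennreal (profile b x) \<partial>lborel)"
        unfolding nn_integral_cell_profile[OF b(1) b4] using b
        by (subst ennreal_mult'[symmetric]) (auto intro!: ennreal_leI)
    qed
    also have "\<dots> = ennreal ?K * (\<integral>\<^sup>+x\<in>cell k i. ennreal (profile b x) \<partial>lborel)"
      using b by (simp add: ennreal_mult' mult.assoc)
    also have "\<dots> \<le> ennreal ?K * ?R"
      using small by (intro mult_left_mono nn_integral_mono) (auto simp: indicator_def)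
    finally show ?thesis .
  qed
qed

section \<open>The weight on the whole space\<close>

lemma coordinate_measurable [measurable]: "(\<lambda>x :: real ^ 'n. x $ a) \<in> borel_measurable borel"
  by (intro borel_measurable_continuous_onI continuous_intros)

lemma profile_coordinate_measurable: "(\<lambda>x :: real ^ 'n. profile b (x $ a)) \<in> borel_measurable borel"
  by (rule measurable_compose[OF coordinate_measurable profile_measurable])

lemma slab_measurable:
  assumes "A \<in> sets borel"
  shows "{x \<in> cube c l. x $ a \<in> A} \<in> sets borel"
proof -
  have "{x \<in> cube c l. x $ a \<in> A} = cube c l \<inter> (\<lambda>x. x $ a) -` A" by auto
  then show ?thesis using measurable_sets_borel[OF coordinate_measurable assms, of a] by auto
qed

lemma sets_lebesgue_if_borel: "A \<in> sets borel \<Longrightarrow> A \<in> sets lebesgue"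
  by (rule sets_completionI_sets) simp

lemma mass_slab_cube:
  fixes c :: "real ^ 'n"
  assumes "A \<in> sets borel" "0 < l"
  shows "emeasure (weight_measure (\<lambda>x. profile b (x $ a))) {x \<in> cube c l. x $ a \<in> A}
     = ennreal (l ^ (CARD('n) - 1)) * (\<integral>\<^sup>+t\<in>{c $ a - l / 2 .. c $ a + l / 2} \<inter> A. ennreal (profile b t) \<partial>lborel)"
proof -
  note [measurable] = assms(1)
  have g: "(\<lambda>t. ennreal (profile b t) * indicator A t) \<in> borel_measurable borel" by measurable
  have E: "{x \<in> cube c l. x $ a \<in> A} \<in> sets lebesgue"
    by (rule sets_lebesgue_if_borel[OF slab_measurable[OF assms(1)]])
  have "emeasure (weight_measure (\<lambda>x. profile b (x $ a))) {x \<in> cube c l. x $ a \<in> A}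
      = (\<integral>\<^sup>+x\<in>{x \<in> cube c l. x $ a \<in> A}. ennreal (profile b (x $ a)) \<partial>lborel)"
    using emeasure_weight_measure[OF profile_coordinate_measurable E] unfolding nn_integral_completion .
  also have "\<dots> = (\<integral>\<^sup>+x\<in>cube c l. (ennreal (profile b (x $ a)) * indicator A (x $ a)) \<partial>lborel)"
    by (intro nn_integral_cong) (auto simp: indicator_def)
  also have "\<dots> = ennreal (l ^ (CARD('n) - 1)) *
      (\<integral>\<^sup>+t\<in>{c $ a - l / 2 .. c $ a + l / 2}. (ennreal (profile b t) * indicator A t) \<partial>lborel)"
    by (rule nn_integral_cube_coordinate[OF g assms(2)])
  also have "(\<integral>\<^sup>+t\<in>{c $ a - l / 2 .. c $ a + l / 2}. (ennreal (profile b t) * indicator A t) \<partial>lborel)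
     = (\<integral>\<^sup>+t\<in>{c $ a - l / 2 .. c $ a + l / 2} \<inter> A. ennreal (profile b t) \<partial>lborel)"
    by (intro nn_integral_cong) (auto simp: indicator_def)
  finally show ?thesis .
qed

lemma lebesgue_slab_cube:
  fixes c :: "real ^ 'n"
  assumes [measurable]: "A \<in> sets borel" and l: "0 < l"
  shows "emeasure lebesgue {x \<in> cube c l. x $ a \<in> A}
     = ennreal (l ^ (CARD('n) - 1)) * emeasure lborel ({c $ a - l / 2 .. c $ a + l / 2} \<inter> A)"
proof -
  have E: "{x \<in> cube c l. x $ a \<in> A} \<in> sets lborel"
    using slab_measurable[OF assms(1)] by simp
  have "emeasure lebesgue {x \<in> cube c l. x $ a \<in> A} = emeasure lborel {x \<in> cube c l. x $ a \<in> A}"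
    using E by simp
  also have "\<dots> = (\<integral>\<^sup>+x. indicator {x \<in> cube c l. x $ a \<in> A} x \<partial>lborel)" using E by simp
  also have "\<dots> = (\<integral>\<^sup>+x\<in>cube c l. indicator A (x $ a) \<partial>lborel)"
    by (intro nn_integral_cong) (auto simp: indicator_def)
  also have "\<dots> = ennreal (l ^ (CARD('n) - 1)) *
      (\<integral>\<^sup>+t\<in>{c $ a - l / 2 .. c $ a + l / 2}. indicator A t \<partial>lborel)"
    by (rule nn_integral_cube_coordinate[OF borel_measurable_indicator[OF assms(1)] l])
  also have "(\<integral>\<^sup>+t\<in>{c $ a - l / 2 .. c $ a + l / 2}. indicator A t \<partial>lborel)
     = (\<integral>\<^sup>+t. indicator ({c $ a - l / 2 .. c $ a + l / 2} \<inter> A) t \<partial>lborel)"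
    by (intro nn_integral_cong) (auto simp: indicator_def)
  also have "\<dots> = emeasure lborel ({c $ a - l / 2 .. c $ a + l / 2} \<inter> A)"
    by (rule nn_integral_indicator) measurable
  finally show ?thesis .
qed

text \<open>
  On a cube over the cell \<open>2\<close> of level \<open>Suc j\<close>, the slab over the peak
  set has proportion of volume at most \<open>(9/10) ^ j\<close> and proportion of mass at
  least \<open>1 - (9/10) ^ j\<close>. No power of the former can bound the latter for large
  \<open>j\<close>.
\<close>
lemma not_A_infinity_profile:
  assumes b: "0 < b" "b \<le> 1/4"
  shows "\<not> A_infinity (\<lambda>x :: real ^ 'n. profile b (x $ a))"
proof
  let ?w = "\<lambda>x :: real ^ 'n. profile b (x $ a)"
  assume "A_infinity ?w"
  then obtain C \<epsilon> where C: "0 < C" "0 < \<epsilon>" and A: "\<forall>c l E. 0 < l \<and> E \<in> sets lebesgue \<and> E \<subseteq> cube c l \<longrightarrow>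
      emeasure (weight_measure ?w) E / emeasure (weight_measure ?w) (cube c l)
        \<le> ennreal (C * (measure lebesgue E / measure lebesgue (cube c l)) powr \<epsilon>)"
    unfolding A_infinity_def by (elim exE conjE) (rule that)
  have step: "1 - (9/10) ^ j \<le> C * ((9/10) powr \<epsilon>) ^ j" for j
  proof -
    \<comment> \<open>The cell 2 of level Suc j is the interval from 2 * l to 3 * l, with centre 5 / 2 * l.\<close>
    define l :: real where "l = 1 / 4 ^ Suc j"
    define c :: "real ^ 'n" where "c = (\<chi> i. (5 / 2) * l)"
    define E where "E = {x \<in> cube c l. x $ a \<in> peak_set b j}"
    define D where "D = l ^ (CARD('n) - 1)"
    have l: "0 < l" by (simp add: l_def)
    have D: "0 < D" using l by (simp add: D_def)
    have Dl: "D * l = l ^ CARD('n)" unfolding D_def by (rule power_minus_mult) simp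
    have seg: "{c $ a - l / 2 .. c $ a + l / 2} = {2 * l .. 3 * l}"
    proof -
      have "c $ a - l / 2 = 2 * l" "c $ a + l / 2 = 3 * l" by (simp_all add: c_def)
      then show ?thesis by simp
    qed
    have cell: "cell (Suc j) 2 = {2 * l ..< 3 * l}"
      unfolding cell_def l_def by simp
    have peak: "peak_set b j \<subseteq> {2 * l .. 3 * l}" unfolding peak_set_def cell by auto
    then have int: "{2 * l .. 3 * l} \<inter> peak_set b j = peak_set b j" by blast
    have E: "E \<in> sets lebesgue" "E \<subseteq> cube c l"
    proof -
      show "E \<in> sets lebesgue" unfolding E_def
        by (rule sets_lebesgue_if_borel[OF slab_measurable[OF peak_set_measurable]])
      show "E \<subseteq> cube c l" by (auto simp: E_def)
    qed
    have "emeasure lebesgue E = ennreal D * emeasure lborel (peak_set b j)"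
      unfolding E_def D_def lebesgue_slab_cube[OF peak_set_measurable l] seg int ..
    also have "\<dots> \<le> ennreal D * ennreal ((9/10) ^ j * l)"
      using peak_set_small[OF b, of j] by (intro mult_left_mono) (auto simp: l_def)
    also have "\<dots> = ennreal ((9/10) ^ j * l ^ CARD('n))"
      using D by (simp add: ennreal_mult'[symmetric] Dl[symmetric] mult_ac)
    finally have "measure lebesgue E \<le> (9/10) ^ j * l ^ CARD('n)"
      unfolding measure_def using l by (intro enn2real_leI) auto
    then have "measure lebesgue E / measure lebesgue (cube c l) \<le> (9/10) ^ j"
      using l unfolding measure_cube[OF l] by (simp add: pos_divide_le_eq)
    then have "(measure lebesgue E / measure lebesgue (cube c l)) powr \<epsilon> \<le> ((9/10) ^ j) powr \<epsilon>"
      using C by (intro powr_mono2) auto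
    also have "((9/10) ^ j) powr \<epsilon> = ((9/10) powr \<epsilon>) ^ j"
      by (simp add: powr_realpow[symmetric] powr_powr mult.commute)
    finally have small: "C * (measure lebesgue E / measure lebesgue (cube c l)) powr \<epsilon> \<le> C * ((9/10) powr \<epsilon>) ^ j"
      using C by simp
    have "emeasure (weight_measure ?w) (cube c l) = emeasure (weight_measure ?w) {x \<in> cube c l. x $ a \<in> UNIV}" by simp
    also have "\<dots> = ennreal D * (\<integral>\<^sup>+t\<in>{2 * l .. 3 * l}. ennreal (profile b t) \<partial>lborel)"
      by (subst mass_slab_cube[OF _ l]) (simp_all add: D_def seg)
    also have "(\<integral>\<^sup>+t\<in>{2 * l .. 3 * l}. ennreal (profile b t) \<partial>lborel) = (\<integral>\<^sup>+t\<in>cell (Suc j) 2. ennreal (profile b t) \<partial>lborel)"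
    proof (rule nn_integral_cong_AE)
      show "AE t in lborel. ennreal (profile b t) * indicator {2 * l .. 3 * l} t
          = ennreal (profile b t) * indicator (cell (Suc j) 2) t"
        using AE_lborel_singleton[of "3 * l"] by eventually_elim (auto simp: indicator_def cell)
    qed
    also have "\<dots> = ennreal (b ^ j * l)"
      unfolding nn_integral_cell_profile[OF b] l_def by (simp add: mirror_def cell_density_0) (simp add: cell_factor_def)
    also have "ennreal D * \<dots> = ennreal (D * (b ^ j * l))" using D by (simp add: ennreal_mult')
    finally have cubeW: "emeasure (weight_measure ?w) (cube c l) = ennreal (D * (b ^ j * l))" .
    have "ennreal (D * (b ^ j * (1 - (9/10) ^ j) * l)) = ennreal D * ennreal (b ^ j * (1 - (9/10) ^ j) * l)"
      using D by (simp add: ennreal_mult')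
    also have "\<dots> \<le> ennreal D * (\<integral>\<^sup>+t\<in>peak_set b j. ennreal (profile b t) \<partial>lborel)"
      using peak_set_heavy[OF b, of j] by (intro mult_left_mono) (auto simp: l_def)
    also have "\<dots> = emeasure (weight_measure ?w) E"
      unfolding E_def D_def mass_slab_cube[OF peak_set_measurable l] seg int ..
    finally have EW: "ennreal (D * (b ^ j * (1 - (9/10) ^ j) * l)) \<le> emeasure (weight_measure ?w) E" .
    have "(9/10 :: real) ^ j \<le> 1" by (rule power_le_one) auto
    then have "ennreal (1 - (9/10) ^ j) = ennreal (D * (b ^ j * (1 - (9/10) ^ j) * l)) / ennreal (D * (b ^ j * l))"
      using D b l by (subst divide_ennreal) auto
    also have "\<dots> \<le> emeasure (weight_measure ?w) E / emeasure (weight_measure ?w) (cube c l)"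
      unfolding cubeW by (rule divide_right_mono_ennreal[OF EW])
    also have "\<dots> \<le> ennreal (C * (measure lebesgue E / measure lebesgue (cube c l)) powr \<epsilon>)"
      by (rule A[rule_format, OF conjI[OF l conjI[OF E]]])
    also have "\<dots> \<le> ennreal (C * ((9/10) powr \<epsilon>) ^ j)" by (rule ennreal_leI[OF small])
    finally show ?thesis using C by simp
  qed
  have "(\<lambda>j. 1 - (9/10 :: real) ^ j) \<longlonglongrightarrow> 1 - 0" by (intro tendsto_intros LIMSEQ_realpow_zero) auto
  moreover have "(\<lambda>j. C * ((9/10) powr \<epsilon>) ^ j) \<longlonglongrightarrow> C * 0"
  proof (rule tendsto_mult[OF tendsto_const LIMSEQ_realpow_zero])
    show "(9/10 :: real) powr \<epsilon> < 1" using powr_less_mono2[of \<epsilon> "9/10" 1] C by simp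
  qed auto
  ultimately have "1 - 0 \<le> C * 0"
    by (rule LIMSEQ_le) (use step in auto)
  then show False by simp
qed

lemma doubling_profile:
  assumes b: "0 < b" "b \<le> 1/25"
  shows "doubling (\<lambda>x :: real ^ 'n. profile b (x $ a))"
proof -
  let ?w = "\<lambda>x :: real ^ 'n. profile b (x $ a)"
  let ?\<omega> = "weight_measure ?w"
  have mass: "emeasure ?\<omega> (cube c l) = ennreal (l ^ (CARD('n) - 1)) *
      (\<integral>\<^sup>+t\<in>{c $ a - l / 2 .. c $ a + l / 2}. ennreal (profile b t) \<partial>lborel)" if "0 < l" for c l
    using mass_slab_cube[OF _ that, of UNIV b a c] by simp
  define K where "K = 2 ^ (CARD('n) - 1) * (33 * (2 / b) ^ 16)"
  have "0 < K" using b by (simp add: K_def)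
  moreover have "emeasure ?\<omega> (cube c (2 * l)) \<le> ennreal K * emeasure ?\<omega> (cube c l)" if l: "0 < l" for c l
  proof -
    have "emeasure ?\<omega> (cube c (2 * l)) = ennreal ((2 * l) ^ (CARD('n) - 1)) *
        (\<integral>\<^sup>+t\<in>{c $ a - l .. c $ a + l}. ennreal (profile b t) \<partial>lborel)"
      using mass[of "2 * l" c] l by simp
    also have "\<dots> \<le> ennreal ((2 * l) ^ (CARD('n) - 1)) * (ennreal (33 * (2 / b) ^ 16) *
        (\<integral>\<^sup>+t\<in>{c $ a - l / 2 .. c $ a + l / 2}. ennreal (profile b t) \<partial>lborel))"
      by (intro mult_left_mono profile_doubling b l) simp
    also have "\<dots> = ennreal K * emeasure ?\<omega> (cube c l)"
    proof -
      have "ennreal ((2 * l) ^ (CARD('n) - 1)) * ennreal (33 * (2 / b) ^ 16) = ennreal K * ennreal (l ^ (CARD('n) - 1))"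
        unfolding K_def using l b by (simp add: ennreal_mult'[symmetric] power_mult_distrib mult_ac)
      then show ?thesis unfolding mass[OF l] by (simp only: mult.assoc[symmetric])
    qed
    finally show ?thesis .
  qed
  moreover have "emeasure ?\<omega> (space ?\<omega>) \<noteq> 0"
  proof
    assume 0: "emeasure ?\<omega> (space ?\<omega>) = 0"
    have "ennreal (1 / 4) = (\<integral>\<^sup>+t\<in>cell 1 4. ennreal (profile b t) \<partial>lborel)"
      using nn_integral_cell_profile[of b 1 4] b by (simp add: mirror_def cell_factor_def)
    also have "\<dots> \<le> (\<integral>\<^sup>+t\<in>{1..2}. ennreal (profile b t) \<partial>lborel)"
      by (intro nn_integral_mono) (auto simp: indicator_def cell_def)
    also have "\<dots> = emeasure ?\<omega> (cube (\<chi> i. 3 / 2) 1)" by (simp add: mass)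
    also have "\<dots> \<le> emeasure ?\<omega> (space ?\<omega>)" by (intro emeasure_mono) (auto simp: weight_measure_def)
    finally show False using 0 by simp
  qed
  ultimately show ?thesis unfolding doubling_def doubling_measure_def by blast
qed

lemma weight_profile:
  assumes b: "0 < b" "b \<le> 1/25"
  shows "weight (\<lambda>x :: real ^ 'n. profile b (x $ a))"
proof -
  let ?w = "\<lambda>x :: real ^ 'n. profile b (x $ a)"
  have nn: "0 \<le> profile b t" "profile b t \<le> 4" for t using profile_bounds[of b] b by auto
  have meas: "?w \<in> borel_measurable borel" by (rule profile_coordinate_measurable)
  have wl: "?w \<in> borel_measurable lebesgue" by (rule measurable_completion) (use meas in simp)
  have "set_integrable lebesgue K ?w" if K: "compact K" for K
  proof -
    have "K \<in> lmeasurable" using K by (rule lmeasurable_compact)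
    then have "K \<in> sets lebesgue" "emeasure lebesgue K < \<infinity>" by (auto simp: fmeasurable_def)
    then show ?thesis unfolding set_integrable_def
      using nn wl by (intro integrableI_bounded_set_indicator[where B = 4]) auto
  qed
  moreover have "\<not> (AE x in lebesgue. ?w x = 0)"
  proof
    assume "AE x in lebesgue. ?w x = 0"
    then have "emeasure (weight_measure ?w) (space (weight_measure ?w)) = 0"
      unfolding weight_measure_def using wl
      by (subst emeasure_density) (auto simp: nn_integral_0_iff_AE)
    then show False using doubling_profile[OF b, of a] unfolding doubling_def doubling_measure_def by blast
  qed
  ultimately show ?thesis unfolding weight_def locally_integrable_def using nn wl by auto
qed

lemma C_p_condition_profile:
  fixes a :: "'n::finite"
  assumes p: "1 < p" and M: "3 \<le> M" "1 + 2 * (real CARD('n) * (p - 1)) \<le> real M"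
  shows "C_p_condition p (\<lambda>x :: real ^ 'n. profile (1 / 4 ^ M) (x $ a))"
proof -
  define b :: real where "b = 1 / 4 ^ M"
  define m where "m = real CARD('n) * (p - 1)"
  have m: "0 \<le> m" using p by (simp add: m_def)
  have "(4::real) ^ 3 \<le> 4 ^ M" by (rule power_increasing) (use M in auto)
  then have b: "0 < b" "b \<le> 1/4" unfolding b_def by (auto simp: field_simps)
  define H where "H = 2 / b + 4 powr (1 + 4 * m)"
  have "C_p_condition p (\<lambda>x :: real ^ 'n. profile b (x $ a))"
  proof (rule C_p_condition_if_oscillation[OF p, where B = 4 and H = H])
    show "0 \<le> H" using b by (simp add: H_def)
    fix x y :: "real ^ 'n" and s :: real
    assume "0 < s" "s \<le> 1" and xy: "\<And>i. \<bar>x $ i - y $ i\<bar> \<le> s"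
    have "profile b (x $ a) \<le> H * (profile b (y $ a) + \<bar>x $ a - y $ a\<bar> powr m)"
      unfolding H_def using profile_oscillation[OF M(1) _ m b_def] M(2) by (simp add: m_def)
    also have "\<dots> \<le> H * (profile b (y $ a) + s powr m)"
      using xy[of a] m \<open>0 \<le> H\<close> by (intro mult_left_mono add_left_mono powr_mono2) auto
    finally show "profile b (x $ a) \<le> H * (profile b (y $ a) + s powr (real CARD('n) * (p - 1)))"
      unfolding m_def .
  next
    fix c :: "real ^ 'n" and t :: real assume t: "1 \<le> t"
    \<comment> \<open>Moving away from the hyperplane where the coordinate vanishes reaches the region where the profile is 1.\<close>
    define c' where "c' = c + (if 0 \<le> c $ a then 2 * t else - 2 * t) *\<^sub>R axis a 1"
    have ca: "c' $ a = c $ a + (if 0 \<le> c $ a then 2 * t else - 2 * t)" by (simp add: c'_def)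
    have ci: "\<bar>c' $ i - c $ i\<bar> \<le> 2 * t" for i using t by (auto simp: c'_def axis_def)
    show "\<exists>c'. cube c' t \<subseteq> cube c (5 * t) \<and> (\<forall>x\<in>cube c' t. 1 \<le> profile b (x $ a))"
    proof (intro exI[of _ c'] conjI ballI subsetI)
      fix x assume x: "x \<in> cube c' t"
      have d: "\<bar>x $ i - c' $ i\<bar> \<le> t / 2" for i using x unfolding mem_cube_iff by blast
      have "\<bar>x $ i - c $ i\<bar> \<le> 5 * t / 2" for i using d[of i] ci[of i] by linarith
      then show "x \<in> cube c (5 * t)" unfolding mem_cube_iff by blast
      have "x $ a < - 1 \<or> 1 \<le> x $ a" 
      proof -
        have "2 * t \<le> c' $ a \<or> c' $ a \<le> - 2 * t" using ca by (auto split: if_splits)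
        then show ?thesis using d[of a] t by linarith
      qed
      then show "1 \<le> profile b (x $ a)" by (simp add: profile_outside)
    qed
  qed (use profile_bounds[OF b] profile_coordinate_measurable in \<open>auto\<close>)
  then show ?thesis unfolding b_def .
qed

theorem theorem1:
  fixes p :: real
  assumes "1 < p"
  shows "\<exists>w :: real ^ 'n \<Rightarrow> real. weight w \<and> doubling w \<and> C_p_condition p w \<and> \<not> A_infinity w"
proof -
  obtain M0 :: nat where M0: "1 + 2 * (real CARD('n) * (p - 1)) \<le> real M0" using real_arch_simple by blast
  define M where "M = max 3 M0"
  have M: "3 \<le> M" "1 + 2 * (real CARD('n) * (p - 1)) \<le> real M" using M0 by (auto simp: M_def)
  have "(4::real) ^ 3 \<le> 4 ^ M" by (rule power_increasing) (use M in auto)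
  then have b: "0 < 1 / (4::real) ^ M" "1 / (4::real) ^ M \<le> 1/25" "1 / (4::real) ^ M \<le> 1/4" by (auto simp: field_simps)
  define a :: 'n where "a = undefined"
  show ?thesis
    using weight_profile[OF b(1,2), of a] doubling_profile[OF b(1,2), of a] C_p_condition_profile[OF assms M, of a]
      not_A_infinity_profile[OF b(1,3), of a] by blast
qed

end
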